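(* Let $\psi\colon G\twoheadrightarrow H$ be an epimorphism of groups, let $R$ be a principal $G$-graded ring, and let $M$ be a $G$-graded $R$-module. a) If $M$ is projective, then it is free. b) $M$ is free if and only if the $H$-graded $R_{[\psi]}$-module $M_{[\psi]}$ is free.
   Context: Groups are commutative and written additively; rings are commutative with $1$. A $G$-graded ring is a ring $R$ with a family $(R_g)_{g\in G}$ of additive subgroups whose direct sum is $R$ and with $R_gR_h\subseteq R_{g+h}$. A $G$-graded $R$-module is an $R$-module $M$ with a family $(M_g)_{g\in G}$ of additive subgroups whose direct sum is $M$ and with $R_gM_h\subseteq M_{g+h}$. Morphisms of $G$-graded $R$-modules are $R$-linear maps $u\colon M\to N$ with $u(M_g)\subseteq N_g$ for all $g$; "projective" means projective in the category of $G$-graded $R$-modules with these morphisms. For an epimorphism of groups $\psi\colon G\twoheadrightarrow H$, the $\psi$-coarsening $R_{[\psi]}$ (resp. $M_{[\psi]}$) is the $H$-graded ring (resp. $H$-graded $R_{[\psi]}$-module) with the same underlying ring (resp. module) and with component of degree $h\in H$ equal to $\bigoplus_{g\in\psi^{-1}(h)}R_g$ (resp. $\bigoplus_{g\in\psi^{-1}(h)}M_g$). A graded module is free if it has a basis consisting of homogeneous elements. A graded ring $R$ is principal if it is entire (i.e. $R\neq 0$ and every nonzero homogeneous element is a non-zerodivisor) and every graded ideal of $R$ is generated by a single homogeneous element. *)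

theory Defs
  imports "HOL-Algebra.Module" "HOL-Algebra.Ideal"
begin

text \<open>
  The grading groups are commutative groups in the sense of \<^locale>\<open>comm_group\<close>; the library
  writes them multiplicatively, so \<open>g \<otimes>\<^bsub>G\<^esub> h\<close> is the \<open>g + h\<close> of the additive notation.
  A grading is a family of subsets of the carrier, relevant only at indices in \<^term>\<open>carrier G\<close>.
\<close>

definition family_sum :: "('a, 'c) ring_scheme \<Rightarrow> 'i set \<Rightarrow> ('i \<Rightarrow> 'a set) \<Rightarrow> 'a set" where
  "family_sum S I D =
     {x. \<exists>F f. finite F \<and> F \<subseteq> I \<and> f \<in> (\<Pi> i\<in>F. D i) \<and> x = (\<Oplus>\<^bsub>S\<^esub>i\<in>F. f i)}"

definition internal_direct_sum ::
  "('a, 'c) ring_scheme \<Rightarrow> 'i set \<Rightarrow> ('i \<Rightarrow> 'a set) \<Rightarrow> 'a set \<Rightarrow> bool" where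
  "internal_direct_sum S I D A \<longleftrightarrow>
     (\<forall>i\<in>I. additive_subgroup (D i) S) \<and>
     A = family_sum S I D \<and>
     (\<forall>F f. finite F \<longrightarrow> F \<subseteq> I \<longrightarrow> f \<in> (\<Pi> i\<in>F. D i) \<longrightarrow>
        (\<Oplus>\<^bsub>S\<^esub>i\<in>F. f i) = \<zero>\<^bsub>S\<^esub> \<longrightarrow> (\<forall>i\<in>F. f i = \<zero>\<^bsub>S\<^esub>))"

definition homogeneous :: "('g, 'd) monoid_scheme \<Rightarrow> ('g \<Rightarrow> 'a set) \<Rightarrow> 'a set" where
  "homogeneous G D = (\<Union>g\<in>carrier G. D g)"

definition graded_ring ::
  "('g, 'd) monoid_scheme \<Rightarrow> ('r, 'c) ring_scheme \<Rightarrow> ('g \<Rightarrow> 'r set) \<Rightarrow> bool" where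
  "graded_ring G R \<R> \<longleftrightarrow>
     comm_group G \<and> cring R \<and>
     internal_direct_sum R (carrier G) \<R> (carrier R) \<and>
     (\<forall>g\<in>carrier G. \<forall>h\<in>carrier G. \<forall>a\<in>\<R> g. \<forall>b\<in>\<R> h. a \<otimes>\<^bsub>R\<^esub> b \<in> \<R> (g \<otimes>\<^bsub>G\<^esub> h))"

definition graded_module ::
  "('g, 'd) monoid_scheme \<Rightarrow> ('r, 'c) ring_scheme \<Rightarrow> ('g \<Rightarrow> 'r set) \<Rightarrow>
   ('r, 'm, 'e) module_scheme \<Rightarrow> ('g \<Rightarrow> 'm set) \<Rightarrow> bool" where
  "graded_module G R \<R> M \<M> \<longleftrightarrow>
     graded_ring G R \<R> \<and> module R M \<and>
     internal_direct_sum M (carrier G) \<M> (carrier M) \<and>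
     (\<forall>g\<in>carrier G. \<forall>h\<in>carrier G. \<forall>a\<in>\<R> g. \<forall>x\<in>\<M> h. a \<odot>\<^bsub>M\<^esub> x \<in> \<M> (g \<otimes>\<^bsub>G\<^esub> h))"

definition graded_hom ::
  "('g, 'd) monoid_scheme \<Rightarrow> ('r, 'c) ring_scheme \<Rightarrow>
   ('r, 'm, 'e) module_scheme \<Rightarrow> ('g \<Rightarrow> 'm set) \<Rightarrow>
   ('r, 'n, 'f) module_scheme \<Rightarrow> ('g \<Rightarrow> 'n set) \<Rightarrow> ('m \<Rightarrow> 'n) set" where
  "graded_hom G R M \<M> N \<N> =
     {u. u \<in> carrier M \<rightarrow> carrier N \<and>
         (\<forall>x\<in>carrier M. \<forall>y\<in>carrier M. u (x \<oplus>\<^bsub>M\<^esub> y) = u x \<oplus>\<^bsub>N\<^esub> u y) \<and>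
         (\<forall>a\<in>carrier R. \<forall>x\<in>carrier M. u (a \<odot>\<^bsub>M\<^esub> x) = a \<odot>\<^bsub>N\<^esub> u x) \<and>
         (\<forall>g\<in>carrier G. u ` \<M> g \<subseteq> \<N> g)}"

text \<open>
  HOL cannot quantify over types inside a definition, so the objects of the category range over
  the graded modules whose carrier lies in a fixed type \<open>'u\<close>, the universe. Maps are compared on
  the carriers only. The notion of epimorphism does not depend on the universe: a quotient of a
  module living in \<open>'u\<close> has a copy in \<open>'u\<close> (choose coset representatives), so the epimorphisms
  below are exactly the surjective morphisms.
\<close>

definition graded_epi ::
  "('g, 'd) monoid_scheme \<Rightarrow> ('r, 'c) ring_scheme \<Rightarrow> ('g \<Rightarrow> 'r set) \<Rightarrow>
   ('r, 'u) module \<Rightarrow> ('g \<Rightarrow> 'u set) \<Rightarrow> ('r, 'u) module \<Rightarrow> ('g \<Rightarrow> 'u set) \<Rightarrow> ('u \<Rightarrow> 'u) set" where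
  "graded_epi G R \<R> N \<N> P \<P> =
     {f \<in> graded_hom G R N \<N> P \<P>.
        \<forall>(Q :: ('r, 'u) module) \<Q> v w.
          graded_module G R \<R> Q \<Q> \<longrightarrow>
          v \<in> graded_hom G R P \<P> Q \<Q> \<longrightarrow> w \<in> graded_hom G R P \<P> Q \<Q> \<longrightarrow>
          (\<forall>x\<in>carrier N. v (f x) = w (f x)) \<longrightarrow> (\<forall>y\<in>carrier P. v y = w y)}"

text \<open>
  Projectivity of \<open>M\<close> against the universe \<open>'u\<close>. It agrees with projectivity in the category of
  all graded modules as soon as \<open>'u\<close> has room for a copy of \<open>M\<close> and of the free graded module on
  the homogeneous elements of \<open>M\<close>: the canonical epimorphism from the latter then splits, so \<open>M\<close>
  is a graded direct summand of a free graded module. For \<open>M\<close> with elements in \<open>'m\<close> over a nonzero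
  ring with elements in \<open>'r\<close>, graded by a group with elements in \<open>'g\<close>, the type
  \<open>'g \<times> 'm \<Rightarrow> 'r\<close> has this property: it contains all families of coefficients indexed by pairs
  \<open>(g, x)\<close> with \<open>x\<close> of degree \<open>g\<close>, and the indicator functions of single elements of \<open>M\<close>.
\<close>

definition graded_projective ::
  "'u itself \<Rightarrow> ('g, 'd) monoid_scheme \<Rightarrow> ('r, 'c) ring_scheme \<Rightarrow> ('g \<Rightarrow> 'r set) \<Rightarrow>
   ('r, 'm, 'e) module_scheme \<Rightarrow> ('g \<Rightarrow> 'm set) \<Rightarrow> bool" where
  "graded_projective (_ :: 'u itself) G R \<R> M \<M> \<longleftrightarrow>
     (\<forall>(N :: ('r, 'u) module) \<N> (P :: ('r, 'u) module) \<P> f u.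
        graded_module G R \<R> N \<N> \<longrightarrow> graded_module G R \<R> P \<P> \<longrightarrow>
        f \<in> graded_epi G R \<R> N \<N> P \<P> \<longrightarrow> u \<in> graded_hom G R M \<M> P \<P> \<longrightarrow>
        (\<exists>v\<in>graded_hom G R M \<M> N \<N>. \<forall>x\<in>carrier M. f (v x) = u x))"

definition module_basis ::
  "('r, 'c) ring_scheme \<Rightarrow> ('r, 'm, 'e) module_scheme \<Rightarrow> 'm set \<Rightarrow> bool" where
  "module_basis R M B \<longleftrightarrow>
     B \<subseteq> carrier M \<and>
     (\<forall>x\<in>carrier M. \<exists>F c. finite F \<and> F \<subseteq> B \<and> c \<in> F \<rightarrow> carrier R \<and>
        x = (\<Oplus>\<^bsub>M\<^esub>b\<in>F. c b \<odot>\<^bsub>M\<^esub> b)) \<and>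
     (\<forall>F c. finite F \<longrightarrow> F \<subseteq> B \<longrightarrow> c \<in> F \<rightarrow> carrier R \<longrightarrow>
        (\<Oplus>\<^bsub>M\<^esub>b\<in>F. c b \<odot>\<^bsub>M\<^esub> b) = \<zero>\<^bsub>M\<^esub> \<longrightarrow> (\<forall>b\<in>F. c b = \<zero>\<^bsub>R\<^esub>))"

text \<open>Freeness does not involve the grading of \<open>R\<close>, which is therefore not an argument.\<close>

definition graded_free ::
  "('g, 'd) monoid_scheme \<Rightarrow> ('r, 'c) ring_scheme \<Rightarrow>
   ('r, 'm, 'e) module_scheme \<Rightarrow> ('g \<Rightarrow> 'm set) \<Rightarrow> bool" where
  "graded_free G R M \<M> \<longleftrightarrow> (\<exists>B. B \<subseteq> homogeneous G \<M> \<and> module_basis R M B)"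

definition graded_ideal ::
  "('g, 'd) monoid_scheme \<Rightarrow> ('r, 'c) ring_scheme \<Rightarrow> ('g \<Rightarrow> 'r set) \<Rightarrow> 'r set \<Rightarrow> bool" where
  "graded_ideal G R \<R> I \<longleftrightarrow>
     ideal I R \<and> internal_direct_sum R (carrier G) (\<lambda>g. I \<inter> \<R> g) I"

definition graded_entire ::
  "('g, 'd) monoid_scheme \<Rightarrow> ('r, 'c) ring_scheme \<Rightarrow> ('g \<Rightarrow> 'r set) \<Rightarrow> bool" where
  "graded_entire G R \<R> \<longleftrightarrow>
     carrier R \<noteq> {\<zero>\<^bsub>R\<^esub>} \<and>
     (\<forall>a\<in>homogeneous G \<R>. a \<noteq> \<zero>\<^bsub>R\<^esub> \<longrightarrow>
        (\<forall>b\<in>carrier R. a \<otimes>\<^bsub>R\<^esub> b = \<zero>\<^bsub>R\<^esub> \<longrightarrow> b = \<zero>\<^bsub>R\<^esub>))"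

definition graded_principal ::
  "('g, 'd) monoid_scheme \<Rightarrow> ('r, 'c) ring_scheme \<Rightarrow> ('g \<Rightarrow> 'r set) \<Rightarrow> bool" where
  "graded_principal G R \<R> \<longleftrightarrow>
     graded_ring G R \<R> \<and> graded_entire G R \<R> \<and>
     (\<forall>I. graded_ideal G R \<R> I \<longrightarrow> (\<exists>a\<in>homogeneous G \<R>. I = Idl\<^bsub>R\<^esub> {a}))"

text \<open>
  The coarsening changes only the grading: the component of degree \<open>h\<close> is the sum, inside the same
  ring or module, of the components with degree in \<open>\<psi>\<^sup>-\<^sup>1(h)\<close>. The sum is direct whenever \<open>D\<close> is a
  grading.
\<close>

definition coarsening ::
  "('g, 'd) monoid_scheme \<Rightarrow> ('g \<Rightarrow> 'h) \<Rightarrow> ('a, 'c) ring_scheme \<Rightarrow> ('g \<Rightarrow> 'a set) \<Rightarrow> 'h \<Rightarrow> 'a set" where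
  "coarsening G \<psi> S D h = family_sum S {g \<in> carrier G. \<psi> g = h} D"

end

theory Submission
  imports Defs
begin

text \<open>
  The common core of both parts is \<open>free_of_coordinates\<close>: a graded module \<open>M\<close> over a principal
  graded ring is graded free as soon as the underlying module embeds, by an arbitrary linear map,
  into a free module. Such an embedding is recorded by its coordinates, a pointwise finite and
  jointly injective family of linear functionals on \<open>M\<close>.

  The proof has two steps. The first one makes the coordinates homogeneous: a linear functional
  \<open>f\<close> has for every degree \<open>g\<close> a part \<open>degree_part f g\<close>, which sends \<open>x\<close> of degree \<open>k\<close> to the component
  of \<open>f x\<close> of degree \<open>k - g\<close>. The parts of the coordinates, indexed by pairs, are again pointwise
  finite and jointly injective; conceptually, the map \<open>M \<rightarrow> M \<otimes> \<int>[G]\<close>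
  with \<open>x \<mapsto> x \<otimes> k\<close> for \<open>x\<close> of degree \<open>k\<close> is followed by the given embedding, and the result is
  expressed in a homogeneous basis. The second one is the classical
  argument for submodules of free modules over a principal ideal domain, carried out in the locale
  \<open>homogeneous_coordinates\<close>. The index set is well-ordered, and for each index \<open>i\<close> the leading
  coefficients of the elements with no coordinate beyond \<open>i\<close> form a graded ideal, generated by the
  leading coefficient of a homogeneous element \<open>lead i\<close>. The nonzero leading coefficients belong to a
  homogeneous basis: they are non-zerodivisors, so leading terms cannot cancel, and subtracting
  multiples of the \<open>lead i\<close> lowers the leading index, which can happen only finitely often.

  If \<open>M\<close> is projective, the canonical epimorphism onto \<open>M\<close> from the free graded module on the pairs
  \<open>(g, x)\<close> with \<open>x\<close> of degree \<open>g\<close> splits, and the splitting embeds \<open>M\<close> into a free module. If the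
  coarsening is free, then \<open>M\<close> itself is free as a module, and the inverse of the isomorphism given by
  a basis is an embedding. Conversely, an element that is homogeneous for the grading by \<open>G\<close> is
  homogeneous for the coarsening, so a graded basis of \<open>M\<close> is one of the coarsening.
\<close>

section \<open>Components in an internal direct sum\<close>

lemma (in abelian_group_hom) hom_finsum:
  assumes "f \<in> A \<rightarrow> carrier G"
  shows "h (\<Oplus>\<^bsub>G\<^esub>i\<in>A. f i) = (\<Oplus>\<^bsub>H\<^esub>i\<in>A. h (f i))"
proof (cases "finite A")
  case True
  then show ?thesis
    using assms
  proof (induction A)
    case (insert j A)
    then have "f \<in> A \<rightarrow> carrier G" "(\<lambda>i. h (f i)) \<in> A \<rightarrow> carrier H" "f j \<in> carrier G"
      using hom_closed by (auto simp: Pi_iff)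
    with insert show ?case
      by (simp add: G.finsum_insert H.finsum_insert hom_add G.finsum_closed)
  qed simp
next
  case False
  then show ?thesis by (simp add: G.finsum_infinite H.finsum_infinite)
qed

lemma abelian_group_homI:
  assumes "abelian_group S" and "abelian_group T" and "f \<in> carrier S \<rightarrow> carrier T"
    and "\<And>x y. x \<in> carrier S \<Longrightarrow> y \<in> carrier S \<Longrightarrow> f (x \<oplus>\<^bsub>S\<^esub> y) = f x \<oplus>\<^bsub>T\<^esub> f y"
  shows "abelian_group_hom S T f"
proof (intro abelian_group_hom.intro abelian_group_hom_axioms.intro group_hom.intro
    group_hom_axioms.intro assms(1,2) abelian_group.a_group)
  show "f \<in> hom (add_monoid S) (add_monoid T)"
    using assms(3,4) by (simp add: hom_def)
qed

locale direct_sum = abelian_group S for S (structure) +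
  fixes I :: "'i set" and D :: "'i \<Rightarrow> 'a set"
  assumes internal: "internal_direct_sum S I D (carrier S)"
begin

lemma summand_subgroup: "i \<in> I \<Longrightarrow> additive_subgroup (D i) S"
  using internal by (simp add: internal_direct_sum_def)

lemma summand_closed: "i \<in> I \<Longrightarrow> x \<in> D i \<Longrightarrow> x \<in> carrier S"
  using summand_subgroup additive_subgroup.a_subset by blast

lemma summand_zero: "i \<in> I \<Longrightarrow> \<zero> \<in> D i"
  by (rule additive_subgroup.zero_closed[OF summand_subgroup])

lemma summand_add: "i \<in> I \<Longrightarrow> x \<in> D i \<Longrightarrow> y \<in> D i \<Longrightarrow> x \<oplus> y \<in> D i"
  by (rule additive_subgroup.a_closed[OF summand_subgroup])

lemma summand_minus: "i \<in> I \<Longrightarrow> x \<in> D i \<Longrightarrow> \<ominus> x \<in> D i"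
  using subgroup.m_inv_closed[OF additive_subgroup.a_subgroup[OF summand_subgroup], of i x]
  by (simp add: a_inv_def)

lemma independent:
  assumes "finite F" "F \<subseteq> I" "f \<in> (\<Pi> i\<in>F. D i)" "(\<Oplus>i\<in>F. f i) = \<zero>" "i \<in> F"
  shows "f i = \<zero>"
  using internal assms unfolding internal_direct_sum_def by meson

lemma finsum_zero_ext:
  assumes "finite E" and "F \<subseteq> E" and "f \<in> F \<rightarrow> carrier S"
  shows "(\<Oplus>i\<in>E. if i \<in> F then f i else \<zero>) = (\<Oplus>i\<in>F. f i)"
proof (rule add.finprod_mono_neutral_cong_right[OF assms(1,2)])
  show "(\<lambda>i. if i \<in> F then f i else \<zero>) \<in> E \<rightarrow> carrier S"
    using assms(3) by (simp add: Pi_iff)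
qed auto

lemma unique_decomposition:
  assumes F: "finite F" "F \<subseteq> I" and f: "f \<in> (\<Pi> i\<in>F. D i)" and g: "g \<in> (\<Pi> i\<in>F. D i)"
    and eq: "(\<Oplus>i\<in>F. f i) = (\<Oplus>i\<in>F. g i)" and i: "i \<in> F"
  shows "f i = g i"
proof -
  have fc: "f \<in> F \<rightarrow> carrier S" and gc: "g \<in> F \<rightarrow> carrier S"
    using F f g summand_closed by (auto simp: Pi_def subset_iff)
  then have "(\<Oplus>i\<in>F. f i \<oplus> \<ominus> g i) = (\<Oplus>i\<in>F. g i \<oplus> \<ominus> g i)"
    using finsum_addf[of f F "\<lambda>i. \<ominus> g i"] finsum_addf[of g F "\<lambda>i. \<ominus> g i"] eq
    by (simp add: Pi_def)
  also have "\<dots> = \<zero>"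
    using gc by (intro add.finprod_one_eqI) (auto simp: Pi_def r_neg)
  finally have "(\<Oplus>i\<in>F. f i \<oplus> \<ominus> g i) = \<zero>" .
  moreover have "(\<lambda>i. f i \<oplus> \<ominus> g i) \<in> (\<Pi> i\<in>F. D i)"
    using F f g by (auto simp: Pi_def intro!: summand_add summand_minus)
  ultimately have "f i \<oplus> \<ominus> g i = \<zero>"
    using independent[OF F, of "\<lambda>i. f i \<oplus> \<ominus> g i" i] i by simp
  then show ?thesis
    using i fc gc by (metis Pi_mem add.inv_closed add.inv_inv minus_equality)
qed

text \<open>
  Different finite sums that represent \<open>x\<close> may run over different index sets, so the description is
  well defined only through the uniqueness of decompositions.
\<close>
definition component :: "'a \<Rightarrow> 'i \<Rightarrow> 'a" where
  "component x i = (THE y. \<exists>F f. finite F \<and> F \<subseteq> I \<and> f \<in> (\<Pi> i\<in>F. D i) \<and> x = (\<Oplus>i\<in>F. f i) \<and>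
     y = (if i \<in> F then f i else \<zero>))"

text \<open>
  Two decompositions become comparable after both families are extended by zero to the union of
  their index sets.
\<close>
lemma component_finsum:
  assumes "finite F" "F \<subseteq> I" "f \<in> (\<Pi> i\<in>F. D i)"
  shows "component (\<Oplus>i\<in>F. f i) i = (if i \<in> F then f i else \<zero>)"
  unfolding component_def
proof (rule the_equality)
  show "\<exists>F' f'. finite F' \<and> F' \<subseteq> I \<and> f' \<in> (\<Pi> i\<in>F'. D i) \<and>
     (\<Oplus>i\<in>F. f i) = (\<Oplus>i\<in>F'. f' i) \<and>
     (if i \<in> F then f i else \<zero>) = (if i \<in> F' then f' i else \<zero>)"
    using assms by blast
next
  fix y
  assume "\<exists>F' f'. finite F' \<and> F' \<subseteq> I \<and> f' \<in> (\<Pi> i\<in>F'. D i) \<and>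
     (\<Oplus>i\<in>F. f i) = (\<Oplus>i\<in>F'. f' i) \<and> y = (if i \<in> F' then f' i else \<zero>)"
  then obtain F' f' where F': "finite F'" "F' \<subseteq> I" "f' \<in> (\<Pi> i\<in>F'. D i)"
     "(\<Oplus>i\<in>F. f i) = (\<Oplus>i\<in>F'. f' i)" and y: "y = (if i \<in> F' then f' i else \<zero>)"
    by blast
  let ?e = "\<lambda>F f i. if i \<in> F then f i else \<zero>"
  have fc: "f \<in> F \<rightarrow> carrier S" and gc: "f' \<in> F' \<rightarrow> carrier S"
    using F' assms summand_closed by (auto simp: Pi_def subset_iff)
  have "(\<Oplus>i\<in>F\<union>F'. ?e F f i) = (\<Oplus>i\<in>F\<union>F'. ?e F' f' i)"
    using finsum_zero_ext[OF _ _ fc, of "F \<union> F'"] finsum_zero_ext[OF _ _ gc, of "F \<union> F'"]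
      assms F' by auto
  moreover have "?e F f \<in> (\<Pi> i\<in>F\<union>F'. D i)" "?e F' f' \<in> (\<Pi> i\<in>F\<union>F'. D i)"
    using assms F' by (auto simp: Pi_def subset_iff summand_zero)
  ultimately have "?e F f i = ?e F' f' i" if "i \<in> F \<union> F'"
    using unique_decomposition[of "F \<union> F'" "?e F f" "?e F' f'" i] that assms(1,2) F'(1,2) by blast
  then show "y = ?e F f i"
    unfolding y by (cases "i \<in> F \<union> F'") auto
qed

lemma decompose:
  assumes "x \<in> carrier S"
  obtains F f where "finite F" "F \<subseteq> I" "f \<in> (\<Pi> i\<in>F. D i)" "f \<in> F \<rightarrow> carrier S" "x = (\<Oplus>i\<in>F. f i)"
proof -
  have "x \<in> family_sum S I D"
    using assms internal by (simp add: internal_direct_sum_def)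
  then obtain F f where F: "finite F" "F \<subseteq> I" "f \<in> (\<Pi> i\<in>F. D i)" "x = (\<Oplus>i\<in>F. f i)"
    unfolding family_sum_def mem_Collect_eq by (elim exE conjE)
  show thesis
  proof (rule that[OF F(1-3) _ F(4)])
    show "f \<in> F \<rightarrow> carrier S"
      by (rule Pi_I) (rule summand_closed[OF subsetD[OF F(2)] Pi_mem[OF F(3)]])
  qed
qed

lemma component_mem [simp]:
  assumes "x \<in> carrier S" "i \<in> I"
  shows "component x i \<in> D i"
proof -
  obtain F f where F: "finite F" "F \<subseteq> I" "f \<in> (\<Pi> i\<in>F. D i)" "f \<in> F \<rightarrow> carrier S" "x = (\<Oplus>i\<in>F. f i)"
    using decompose[OF assms(1)] .
  show ?thesis
    unfolding F(5) component_finsum[OF F(1-3)] using Pi_mem[OF F(3)] summand_zero[OF assms(2)] by presburger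
qed

lemma component_outside:
  assumes "x \<in> carrier S" "i \<notin> I"
  shows "component x i = \<zero>"
proof -
  obtain F f where F: "finite F" "F \<subseteq> I" "f \<in> (\<Pi> i\<in>F. D i)" "f \<in> F \<rightarrow> carrier S" "x = (\<Oplus>i\<in>F. f i)"
    using decompose[OF assms(1)] .
  show ?thesis
    unfolding F(5) component_finsum[OF F(1-3)] using subsetD[OF F(2), of i] assms(2) by presburger
qed

lemma component_closed [simp]: "x \<in> carrier S \<Longrightarrow> component x i \<in> carrier S"
  using summand_closed[OF _ component_mem, of i x] component_outside[of x i] by fastforce

lemma finite_component:
  assumes "x \<in> carrier S"
  shows "finite {i. component x i \<noteq> \<zero>}"
proof -
  obtain F f where F: "finite F" "F \<subseteq> I" "f \<in> (\<Pi> i\<in>F. D i)" "f \<in> F \<rightarrow> carrier S" "x = (\<Oplus>i\<in>F. f i)"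
    using decompose[OF assms] .
  have "{i. component x i \<noteq> \<zero>} \<subseteq> F"
    unfolding F(5) component_finsum[OF F(1-3)] by (auto split: if_splits)
  then show ?thesis using F(1) finite_subset by blast
qed

lemma component_support: "x \<in> carrier S \<Longrightarrow> {i. component x i \<noteq> \<zero>} \<subseteq> I"
  using component_outside by auto

lemma component_homogeneous:
  assumes "i \<in> I" "x \<in> D i"
  shows "component x j = (if j = i then x else \<zero>)"
proof -
  have "x = (\<Oplus>j\<in>{i}. x)"
    using summand_closed[OF assms] by simp
  then show ?thesis
    using component_finsum[of "{i}" "\<lambda>_. x" j] assms by simp
qed

lemma sum_component:
  assumes x: "x \<in> carrier S" and F: "finite F" "{i. component x i \<noteq> \<zero>} \<subseteq> F"
  shows "(\<Oplus>i\<in>F. component x i) = x"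
proof -
  obtain E f where E: "finite E" "E \<subseteq> I" "f \<in> (\<Pi> i\<in>E. D i)" "f \<in> E \<rightarrow> carrier S" "x = (\<Oplus>i\<in>E. f i)"
    using decompose[OF x] .
  have component: "component x i = (if i \<in> E then f i else \<zero>)" for i
    unfolding E(5) using component_finsum[OF E(1-3)] .
  have "(\<Oplus>i\<in>E. f i) = (\<Oplus>i\<in>E. component x i)"
    using E(4) component by (intro finsum_cong') auto
  also have "\<dots> = (\<Oplus>i\<in>E \<union> F. component x i)"
    using E(1) F(1) x component by (intro add.finprod_mono_neutral_cong_left Pi_I component_closed) auto
  also have "\<dots> = (\<Oplus>i\<in>F. component x i)"
    using E(1) F x by (intro add.finprod_mono_neutral_cong_right Pi_I component_closed) auto
  finally show ?thesis using E(5) by simp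
qed

lemma component_eq_zero: "x \<in> carrier S \<Longrightarrow> (\<And>i. i \<in> I \<Longrightarrow> component x i = \<zero>) \<Longrightarrow> x = \<zero>"
  using sum_component[of x "{}"] component_outside[of x] by auto

lemma component_add:
  assumes x: "x \<in> carrier S" and y: "y \<in> carrier S"
  shows "component (x \<oplus> y) i = component x i \<oplus> component y i"
proof -
  let ?F = "{i. component x i \<noteq> \<zero>} \<union> {i. component y i \<noteq> \<zero>}"
  have F: "finite ?F" "?F \<subseteq> I"
    using x y finite_component component_support by auto
  have "x \<oplus> y = (\<Oplus>i\<in>?F. component x i) \<oplus> (\<Oplus>i\<in>?F. component y i)"
    using sum_component[OF x F(1)] sum_component[OF y F(1)] by simp
  also have "\<dots> = (\<Oplus>i\<in>?F. component x i \<oplus> component y i)"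
    using x y by (intro finsum_addf[symmetric]) simp_all
  finally have "x \<oplus> y = (\<Oplus>i\<in>?F. component x i \<oplus> component y i)" .
  moreover have "(\<lambda>i. component x i \<oplus> component y i) \<in> (\<Pi> i\<in>?F. D i)"
    using x y subsetD[OF F(2)] by (intro Pi_I summand_add component_mem)
  ultimately have "component (x \<oplus> y) i = (if i \<in> ?F then component x i \<oplus> component y i else \<zero>)"
    using component_finsum[OF F] by simp
  then show ?thesis by auto
qed

lemma component_hom: "abelian_group_hom S S (\<lambda>x. component x i)"
  by (intro abelian_group_homI abelian_group_axioms) (auto simp: component_add)

text \<open>
  Identities between additive maps are reduced by this rule to homogeneous arguments, where the
  components are known.
\<close>
lemma homogeneous_induct [consumes 1, case_names zero homog add]:
  assumes x: "x \<in> carrier S" and zero: "P \<zero>"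
    and homog: "\<And>i x. i \<in> I \<Longrightarrow> x \<in> D i \<Longrightarrow> P x"
    and add: "\<And>x y. x \<in> carrier S \<Longrightarrow> y \<in> carrier S \<Longrightarrow> P x \<Longrightarrow> P y \<Longrightarrow> P (x \<oplus> y)"
  shows "P x"
proof -
  obtain E f where E: "finite E" "E \<subseteq> I" "f \<in> (\<Pi> i\<in>E. D i)" "f \<in> E \<rightarrow> carrier S" "x = (\<Oplus>i\<in>E. f i)"
    using decompose[OF x] .
  have "P (\<Oplus>i\<in>E. f i)"
    using E(1-4)
  proof (induction E)
    case empty
    then show ?case using zero by simp
  next
    case (insert j E)
    then have "P (f j)" using homog[of j] by auto
    then show ?case
      using insert add[of "f j" "finsum S f E"] by (simp add: Pi_def)
  qed
  then show ?thesis using E by simp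
qed

lemma finsum_mem_subgroup:
  assumes J: "additive_subgroup J S" and f: "f \<in> F \<rightarrow> J"
  shows "(\<Oplus>i\<in>F. f i) \<in> J"
proof (cases "finite F")
  case True
  then show ?thesis
    using f
  proof (induction F)
    case empty
    show ?case using additive_subgroup.zero_closed[OF J] by simp
  next
    case (insert j F)
    have "f \<in> F \<rightarrow> carrier S" "f j \<in> carrier S"
      using insert.prems additive_subgroup.a_subset[OF J] by auto
    then have "(\<Oplus>i\<in>insert j F. f i) = f j \<oplus> (\<Oplus>i\<in>F. f i)"
      using insert.hyps by simp
    moreover have "f j \<in> J" "(\<Oplus>i\<in>F. f i) \<in> J"
      using insert.prems insert.IH by auto
    ultimately show ?case
      using additive_subgroup.a_closed[OF J] by simp
  qed
next
  case False
  then show ?thesis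
    using additive_subgroup.zero_closed[OF J] by (simp add: finsum_infinite)
qed

text \<open>
  Used to recognise graded ideals: an ideal inherits the grading once it contains the components of
  its elements.
\<close>
lemma internal_direct_sum_subgroup:
  assumes J: "additive_subgroup J S" and component: "\<And>x i. x \<in> J \<Longrightarrow> i \<in> I \<Longrightarrow> component x i \<in> J"
  shows "internal_direct_sum S I (\<lambda>i. J \<inter> D i) J"
  unfolding internal_direct_sum_def
proof (intro conjI ballI allI impI)
  fix i assume "i \<in> I"
  then have "subgroup (J \<inter> D i) (add_monoid S)"
    using add.subgroups_Inter_pair J summand_subgroup
    by (auto simp: additive_subgroup_def)
  then show "additive_subgroup (J \<inter> D i) S"
    by (rule additive_subgroupI)
next
  have Jc: "J \<subseteq> carrier S"
    using J by (rule additive_subgroup.a_subset)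
  show "J = family_sum S I (\<lambda>i. J \<inter> D i)"
  proof (intro equalityI subsetI)
    fix x assume x: "x \<in> J"
    then have xc: "x \<in> carrier S"
      using Jc by auto
    let ?F = "{i. component x i \<noteq> \<zero>}"
    have F: "finite ?F" "?F \<subseteq> I"
      using finite_component[OF xc] component_support[OF xc] .
    have "component x \<in> (\<Pi> i\<in>?F. J \<inter> D i)"
    proof (rule Pi_I)
      fix i assume "i \<in> ?F"
      then have "i \<in> I" using F(2) by (rule rev_subsetD)
      then show "component x i \<in> J \<inter> D i"
        using component[OF x] component_mem[OF xc] by simp
    qed
    moreover have "x = (\<Oplus>i\<in>?F. component x i)"
      using sum_component[OF xc F(1)] by simp
    ultimately show "x \<in> family_sum S I (\<lambda>i. J \<inter> D i)"
      unfolding family_sum_def mem_Collect_eq using F by (intro exI conjI)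
  next
    fix x assume "x \<in> family_sum S I (\<lambda>i. J \<inter> D i)"
    then obtain F f where F: "finite F" "F \<subseteq> I" "f \<in> (\<Pi> i\<in>F. J \<inter> D i)" "x = (\<Oplus>i\<in>F. f i)"
      unfolding family_sum_def mem_Collect_eq by (elim exE conjE)
    then show "x \<in> J"
      using finsum_mem_subgroup[OF J, of f F] by (auto simp: Pi_iff)
  qed
next
  fix F f i
  assume F: "finite F" "F \<subseteq> I" "f \<in> (\<Pi> i\<in>F. J \<inter> D i)" "(\<Oplus>i\<in>F. f i) = \<zero>" "i \<in> F"
  then have "f \<in> (\<Pi> i\<in>F. D i)"
    by (simp add: Pi_iff)
  then show "f i = \<zero>"
    by (rule independent[OF F(1,2) _ F(4,5)])
qed

end

section \<open>Linear functionals and spans\<close>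

definition functional :: "('r, 'c) ring_scheme \<Rightarrow> ('r, 'm, 'e) module_scheme \<Rightarrow> ('m \<Rightarrow> 'r) \<Rightarrow> bool" where
  "functional R M f \<longleftrightarrow>
     abelian_group_hom M R f \<and> (\<forall>a\<in>carrier R. \<forall>x\<in>carrier M. f (a \<odot>\<^bsub>M\<^esub> x) = a \<otimes>\<^bsub>R\<^esub> f x)"

lemma functional_hom: "functional R M f \<Longrightarrow> abelian_group_hom M R f"
  by (simp add: functional_def)

lemma functional_closed: "functional R M f \<Longrightarrow> x \<in> carrier M \<Longrightarrow> f x \<in> carrier R"
  by (blast dest: functional_hom abelian_group_hom.hom_closed)

lemma functional_zero: "functional R M f \<Longrightarrow> f \<zero>\<^bsub>M\<^esub> = \<zero>\<^bsub>R\<^esub>"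
  by (blast dest: functional_hom abelian_group_hom.hom_zero)

lemma functional_add:
  "functional R M f \<Longrightarrow> x \<in> carrier M \<Longrightarrow> y \<in> carrier M \<Longrightarrow> f (x \<oplus>\<^bsub>M\<^esub> y) = f x \<oplus>\<^bsub>R\<^esub> f y"
  by (blast dest: functional_hom abelian_group_hom.hom_add)

lemma functional_smult:
  "functional R M f \<Longrightarrow> a \<in> carrier R \<Longrightarrow> x \<in> carrier M \<Longrightarrow> f (a \<odot>\<^bsub>M\<^esub> x) = a \<otimes>\<^bsub>R\<^esub> f x"
  by (simp add: functional_def)

context module
begin

lemma functional_minus:
  assumes "functional R M f" "x \<in> carrier M"
  shows "f (\<ominus>\<^bsub>M\<^esub> x) = \<ominus>\<^bsub>R\<^esub> f x"
  by (rule R.minus_equality[symmetric])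
    (use assms functional_add[OF assms(1), of "\<ominus>\<^bsub>M\<^esub> x" x] in
      \<open>simp_all add: M.l_neg functional_zero functional_closed\<close>)

definition lin_span :: "'c set \<Rightarrow> 'c set" where
  "lin_span B = {x. \<exists>F c. finite F \<and> F \<subseteq> B \<and> c \<in> F \<rightarrow> carrier R \<and> x = (\<Oplus>\<^bsub>M\<^esub>b\<in>F. c b \<odot>\<^bsub>M\<^esub> b)}"

lemma lin_span_zero: "\<zero>\<^bsub>M\<^esub> \<in> lin_span B"
  unfolding lin_span_def by (auto intro!: exI[of _ "{}"])

lemma lin_span_base:
  assumes "b \<in> B" "b \<in> carrier M" "a \<in> carrier R"
  shows "a \<odot>\<^bsub>M\<^esub> b \<in> lin_span B"
proof -
  have "a \<odot>\<^bsub>M\<^esub> b = (\<Oplus>\<^bsub>M\<^esub>b\<in>{b}. a \<odot>\<^bsub>M\<^esub> b)"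
    using assms by simp
  then show ?thesis
    unfolding lin_span_def mem_Collect_eq using assms
    by (intro exI[of _ "{b}"] exI[of _ "\<lambda>_. a"]) auto
qed

lemma lin_span_add:
  assumes B: "B \<subseteq> carrier M" and "x \<in> lin_span B" "y \<in> lin_span B"
  shows "x \<oplus>\<^bsub>M\<^esub> y \<in> lin_span B"
proof -
  obtain F c where F: "finite F" "F \<subseteq> B" "c \<in> F \<rightarrow> carrier R" "x = (\<Oplus>\<^bsub>M\<^esub>b\<in>F. c b \<odot>\<^bsub>M\<^esub> b)"
    using assms(2) unfolding lin_span_def mem_Collect_eq by (elim exE conjE)
  obtain E d where E: "finite E" "E \<subseteq> B" "d \<in> E \<rightarrow> carrier R" "y = (\<Oplus>\<^bsub>M\<^esub>b\<in>E. d b \<odot>\<^bsub>M\<^esub> b)"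
    using assms(3) unfolding lin_span_def mem_Collect_eq by (elim exE conjE)
  define c' where "c' b = (if b \<in> F then c b else \<zero>)" for b
  define d' where "d' b = (if b \<in> E then d b else \<zero>)" for b
  have cd: "c' b \<in> carrier R" "d' b \<in> carrier R" for b
    using F(3) E(3) by (auto simp: c'_def d'_def)
  have b: "b \<in> carrier M" if "b \<in> F \<union> E" for b
    using that F(2) E(2) B by auto
  have "x = (\<Oplus>\<^bsub>M\<^esub>b\<in>F\<union>E. c' b \<odot>\<^bsub>M\<^esub> b)" "y = (\<Oplus>\<^bsub>M\<^esub>b\<in>F\<union>E. d' b \<odot>\<^bsub>M\<^esub> b)"
    unfolding F(4) E(4) using F(1,3) E(1,3) cd b
    by (auto intro!: M.add.finprod_mono_neutral_cong_left simp: c'_def d'_def dest: Pi_mem)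
  then have "x \<oplus>\<^bsub>M\<^esub> y = (\<Oplus>\<^bsub>M\<^esub>b\<in>F\<union>E. c' b \<odot>\<^bsub>M\<^esub> b \<oplus>\<^bsub>M\<^esub> d' b \<odot>\<^bsub>M\<^esub> b)"
    using cd b M.finsum_addf[of "\<lambda>b. c' b \<odot>\<^bsub>M\<^esub> b" "F \<union> E" "\<lambda>b. d' b \<odot>\<^bsub>M\<^esub> b"] by auto
  also have "\<dots> = (\<Oplus>\<^bsub>M\<^esub>b\<in>F\<union>E. (c' b \<oplus> d' b) \<odot>\<^bsub>M\<^esub> b)"
    using cd b by (intro M.finsum_cong') (auto simp: smult_l_distr)
  finally show ?thesis
    unfolding lin_span_def mem_Collect_eq using F(1,2) E(1,2) cd
    by (intro exI[of _ "F \<union> E"] exI[of _ "\<lambda>b. c' b \<oplus> d' b"]) auto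
qed

end

section \<open>Graded modules\<close>

locale graded_mod =
  fixes G :: "('g, 'd) monoid_scheme" and R :: "('r, 'c) ring_scheme" and \<R> :: "'g \<Rightarrow> 'r set"
    and M :: "('r, 'm, 'e) module_scheme" and \<M> :: "'g \<Rightarrow> 'm set"
  assumes graded_module: "graded_module G R \<R> M \<M>"
begin

lemma graded_ring: "graded_ring G R \<R>"
  using graded_module by (simp add: graded_module_def)

sublocale G: comm_group G
  using graded_ring by (simp add: graded_ring_def)

sublocale module R M
  using graded_module by (simp add: graded_module_def)

sublocale RD: direct_sum R "carrier G" \<R>
  using graded_ring by unfold_locales (simp add: graded_ring_def)

sublocale MD: direct_sum M "carrier G" \<M>
  using graded_module by unfold_locales (simp add: graded_module_def)

lemma ring_mult_mem:
  "g \<in> carrier G \<Longrightarrow> h \<in> carrier G \<Longrightarrow> a \<in> \<R> g \<Longrightarrow> b \<in> \<R> h \<Longrightarrow> a \<otimes>\<^bsub>R\<^esub> b \<in> \<R> (g \<otimes>\<^bsub>G\<^esub> h)"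
  using graded_ring by (simp add: graded_ring_def)

lemma smult_mem:
  "g \<in> carrier G \<Longrightarrow> h \<in> carrier G \<Longrightarrow> a \<in> \<R> g \<Longrightarrow> x \<in> \<M> h \<Longrightarrow> a \<odot>\<^bsub>M\<^esub> x \<in> \<M> (g \<otimes>\<^bsub>G\<^esub> h)"
  using graded_module by (simp add: graded_module_def)

text \<open>
  Both sides are additive in \<open>x\<close>, and for homogeneous \<open>x\<close> they agree because translation by the
  inverse of \<open>d\<close> is injective on degrees.
\<close>
lemma component_functional:
  assumes f: "functional R M f" and d: "d \<in> carrier G"
    and deg: "\<And>k x. k \<in> carrier G \<Longrightarrow> x \<in> \<M> k \<Longrightarrow> f x \<in> \<R> (k \<otimes>\<^bsub>G\<^esub> inv\<^bsub>G\<^esub> d)"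
    and k: "k \<in> carrier G" and x: "x \<in> carrier M"
  shows "RD.component (f x) (k \<otimes>\<^bsub>G\<^esub> inv\<^bsub>G\<^esub> d) = f (MD.component x k)"
  using x
proof (induction x rule: MD.homogeneous_induct)
  case zero
  have "RD.component \<zero>\<^bsub>R\<^esub> i = \<zero>\<^bsub>R\<^esub>" "MD.component \<zero>\<^bsub>M\<^esub> k = \<zero>\<^bsub>M\<^esub>" for i
    by (rule abelian_group_hom.hom_zero, rule RD.component_hom)
      (rule abelian_group_hom.hom_zero, rule MD.component_hom)
  then show ?case
    using functional_zero[OF f] by simp
next
  case (homog l x)
  have "k \<otimes>\<^bsub>G\<^esub> inv\<^bsub>G\<^esub> d = l \<otimes>\<^bsub>G\<^esub> inv\<^bsub>G\<^esub> d \<longleftrightarrow> k = l"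
    using k d homog(1) by simp
  then show ?case
    using RD.component_homogeneous[OF _ deg[OF homog], of "k \<otimes>\<^bsub>G\<^esub> inv\<^bsub>G\<^esub> d"]
      MD.component_homogeneous[OF homog, of k] d homog(1) functional_zero[OF f] by simp
next
  case (add x y)
  then show ?case
    using f by (simp add: functional_add functional_closed RD.component_add MD.component_add)
qed

end

section \<open>Leading terms over a principal graded ring\<close>

text \<open>
  The functionals \<open>\<phi> i\<close> are the coordinates of a degree-preserving embedding of \<open>M\<close> into the free
  graded module with basis elements of degree \<open>d i\<close>. Working with the coordinates alone avoids the
  construction of that free module.
\<close>
locale homogeneous_coordinates = graded_mod G R \<R> M \<M>
  for G :: "('g, 'd) monoid_scheme" and R :: "('r, 'c) ring_scheme" and \<R> :: "'g \<Rightarrow> 'r set"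
    and M :: "('r, 'm, 'e) module_scheme" and \<M> :: "'g \<Rightarrow> 'm set" +
  fixes \<phi> :: "'i \<Rightarrow> 'm \<Rightarrow> 'r" and I :: "'i set" and d :: "'i \<Rightarrow> 'g"
    and less :: "'i \<Rightarrow> 'i \<Rightarrow> bool" (infix \<open>\<prec>\<close> 50)
  assumes principal: "graded_principal G R \<R>"
    and coord: "i \<in> I \<Longrightarrow> functional R M (\<phi> i)"
    and degree: "i \<in> I \<Longrightarrow> d i \<in> carrier G"
    and coord_mem: "i \<in> I \<Longrightarrow> k \<in> carrier G \<Longrightarrow> x \<in> \<M> k \<Longrightarrow> \<phi> i x \<in> \<R> (k \<otimes>\<^bsub>G\<^esub> inv\<^bsub>G\<^esub> d i)"
    and finite_coord: "x \<in> carrier M \<Longrightarrow> finite {i \<in> I. \<phi> i x \<noteq> \<zero>\<^bsub>R\<^esub>}"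
    and coord_inj: "x \<in> carrier M \<Longrightarrow> (\<And>i. i \<in> I \<Longrightarrow> \<phi> i x = \<zero>\<^bsub>R\<^esub>) \<Longrightarrow> x = \<zero>\<^bsub>M\<^esub>"
    and wf: "wfp (\<prec>)"
    and trans: "transp (\<prec>)"
    and total: "i \<noteq> j \<Longrightarrow> i \<prec> j \<or> j \<prec> i"
begin

lemma irrefl: "\<not> i \<prec> i"
  using wf wfp_imp_irreflp irreflpD by metis

lemma asym: "i \<prec> j \<Longrightarrow> \<not> j \<prec> i"
  using trans irrefl transpD by metis

lemma component_coord:
  assumes "i \<in> I" "k \<in> carrier G" "x \<in> carrier M"
  shows "RD.component (\<phi> i x) (k \<otimes>\<^bsub>G\<^esub> inv\<^bsub>G\<^esub> d i) = \<phi> i (MD.component x k)"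
  using coord[OF assms(1)] degree[OF assms(1)] coord_mem[OF assms(1)] assms(2,3)
  by (rule component_functional)

text \<open>
  In the free module this is the intersection of \<open>M\<close> with the span of the basis elements up to \<open>i\<close>.

\<close>
definition below :: "'i \<Rightarrow> 'm set" where
  "below i = {x \<in> carrier M. \<forall>j\<in>I. i \<prec> j \<longrightarrow> \<phi> j x = \<zero>\<^bsub>R\<^esub>}"

lemma below_carrier: "x \<in> below i \<Longrightarrow> x \<in> carrier M"
  by (simp add: below_def)

lemma below_zero: "\<zero>\<^bsub>M\<^esub> \<in> below i"
  by (simp add: below_def functional_zero[OF coord])

lemma below_add: "x \<in> below i \<Longrightarrow> y \<in> below i \<Longrightarrow> x \<oplus>\<^bsub>M\<^esub> y \<in> below i"
  by (simp add: below_def functional_add[OF coord])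

lemma below_smult: "a \<in> carrier R \<Longrightarrow> x \<in> below i \<Longrightarrow> a \<odot>\<^bsub>M\<^esub> x \<in> below i"
  by (simp add: below_def functional_smult[OF coord])

lemma below_minus: "x \<in> below i \<Longrightarrow> \<ominus>\<^bsub>M\<^esub> x \<in> below i"
  by (simp add: below_def functional_minus[OF coord])

text \<open>
  The coordinates commute with taking components, up to a translation of degrees, so the graded
  submodule structure passes to \<open>below i\<close>.
\<close>
lemma below_component:
  assumes "x \<in> below i" "k \<in> carrier G"
  shows "MD.component x k \<in> below i"
proof -
  have "\<phi> j (MD.component x k) = \<zero>\<^bsub>R\<^esub>" if "j \<in> I" "i \<prec> j" for j
  proof -
    have "\<phi> j x = \<zero>\<^bsub>R\<^esub>" using assms(1) that by (simp add: below_def)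
    then show ?thesis
      using component_coord[OF that(1) assms(2) below_carrier[OF assms(1)]]
        abelian_group_hom.hom_zero[OF RD.component_hom] by simp
  qed
  then show ?thesis
    using below_carrier[OF assms(1)] by (simp add: below_def)
qed

text \<open>
  Being the image of a submodule under a linear functional, the set is an ideal. It is graded since
  a component of \<open>\<phi> i x\<close> is the value of \<open>\<phi> i\<close> at a component of \<open>x\<close>, which stays in \<open>below i\<close>.
\<close>
lemma leading_ideal:
  assumes i: "i \<in> I"
  shows "graded_ideal G R \<R> (\<phi> i ` below i)"
proof -
  let ?J = "\<phi> i ` below i"
  note f = coord[OF i]
  have J: "subgroup ?J (add_monoid R)"
  proof (rule R.add.subgroupI)
    show "?J \<subseteq> carrier R"
      using functional_closed[OF f] below_carrier by auto
    show "?J \<noteq> {}"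
      using below_zero by auto
  next
    fix a assume "a \<in> ?J"
    then obtain x where x: "x \<in> below i" "a = \<phi> i x" by auto
    then have "\<ominus>\<^bsub>R\<^esub> a = \<phi> i (\<ominus>\<^bsub>M\<^esub> x)"
      using functional_minus[OF f] below_carrier by simp
    then show "\<ominus>\<^bsub>R\<^esub> a \<in> ?J"
      using below_minus[OF x(1)] by simp
  next
    fix a b assume "a \<in> ?J" "b \<in> ?J"
    then obtain x y where x: "x \<in> below i" "a = \<phi> i x" and y: "y \<in> below i" "b = \<phi> i y" by auto
    then have "a \<oplus>\<^bsub>R\<^esub> b = \<phi> i (x \<oplus>\<^bsub>M\<^esub> y)"
      using functional_add[OF f] below_carrier by simp
    then show "a \<oplus>\<^bsub>R\<^esub> b \<in> ?J"
      using below_add[OF x(1) y(1)] by simp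
  qed
  have mult: "a \<otimes>\<^bsub>R\<^esub> b \<in> ?J" if "b \<in> ?J" "a \<in> carrier R" for a b
  proof -
    from that obtain x where x: "x \<in> below i" "b = \<phi> i x" by auto
    then have "a \<otimes>\<^bsub>R\<^esub> b = \<phi> i (a \<odot>\<^bsub>M\<^esub> x)"
      using functional_smult[OF f that(2)] below_carrier by simp
    then show ?thesis
      using below_smult[OF that(2) x(1)] by simp
  qed
  have ideal: "ideal ?J R"
  proof (rule idealI[OF R.ring_axioms J mult])
    fix a x assume "a \<in> ?J" "x \<in> carrier R"
    moreover from this have "a \<in> carrier R"
      using functional_closed[OF f] below_carrier by auto
    ultimately show "a \<otimes>\<^bsub>R\<^esub> x \<in> ?J"
      using mult[of a x] R.m_comm[of a x] by simp
  qed
  have "RD.component a g \<in> ?J" if "a \<in> ?J" "g \<in> carrier G" for a g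
  proof -
    from that obtain x where x: "x \<in> below i" "a = \<phi> i x" by auto
    have g: "g \<otimes>\<^bsub>G\<^esub> d i \<in> carrier G" "(g \<otimes>\<^bsub>G\<^esub> d i) \<otimes>\<^bsub>G\<^esub> inv\<^bsub>G\<^esub> d i = g"
      using that(2) degree[OF i] by (simp_all add: G.m_assoc)
    have "RD.component a g = \<phi> i (MD.component x (g \<otimes>\<^bsub>G\<^esub> d i))"
      using component_coord[OF i g(1) below_carrier[OF x(1)]] x(2) g(2) by simp
    then show ?thesis
      using below_component[OF x(1) g(1)] by simp
  qed
  then have "internal_direct_sum R (carrier G) (\<lambda>g. ?J \<inter> \<R> g) ?J"
    by (intro RD.internal_direct_sum_subgroup additive_subgroupI J)
  with ideal show ?thesis
    by (simp add: graded_ideal_def)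
qed

text \<open>
  A homogeneous generator \<open>a\<close> of the leading ideal is the value of \<open>\<phi> i\<close> at some \<open>x\<close>, not necessarily
  homogeneous. Only the component of \<open>x\<close> in the degree of \<open>a\<close>, translated by \<open>d i\<close>, contributes to
  \<open>a\<close>, so \<open>x\<close> may be replaced by it.
\<close>
lemma leading_element:
  assumes i: "i \<in> I"
  shows "\<exists>x\<in>homogeneous G \<M> \<inter> below i. \<phi> i x \<in> homogeneous G \<R> \<and>
           (\<forall>y\<in>below i. \<exists>c\<in>carrier R. \<phi> i y = c \<otimes>\<^bsub>R\<^esub> \<phi> i x)"
proof -
  have "\<exists>a\<in>homogeneous G \<R>. \<phi> i ` below i = Idl\<^bsub>R\<^esub> {a}"
    using principal leading_ideal[OF i] by (simp add: graded_principal_def)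
  then obtain a g where a: "\<phi> i ` below i = Idl\<^bsub>R\<^esub> {a}" and g: "g \<in> carrier G" "a \<in> \<R> g"
    by (auto simp: homogeneous_def)
  have ac: "a \<in> carrier R"
    using RD.summand_closed[OF g] .
  have J: "\<phi> i ` below i = {c \<otimes>\<^bsub>R\<^esub> a | c. c \<in> carrier R}"
    unfolding a R.cgenideal_eq_genideal[OF ac, symmetric] cgenideal_def by simp
  have "a \<in> \<phi> i ` below i"
    unfolding a by (rule R.genideal_self'[OF ac])
  then obtain x where x: "x \<in> below i" "a = \<phi> i x" by auto
  have h: "g \<otimes>\<^bsub>G\<^esub> d i \<in> carrier G" "(g \<otimes>\<^bsub>G\<^esub> d i) \<otimes>\<^bsub>G\<^esub> inv\<^bsub>G\<^esub> d i = g"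
    using g(1) degree[OF i] by (simp_all add: G.m_assoc)
  let ?y = "MD.component x (g \<otimes>\<^bsub>G\<^esub> d i)"
  have y: "\<phi> i ?y = a"
    using component_coord[OF i h(1) below_carrier[OF x(1)]] RD.component_homogeneous[OF g, of g] h(2)
    by (simp add: x(2)[symmetric])
  show ?thesis
  proof (intro bexI[of _ ?y] conjI IntI ballI)
    show "\<phi> i ?y \<in> homogeneous G \<R>"
      unfolding y homogeneous_def using g by auto
    show "?y \<in> homogeneous G \<M>"
      unfolding homogeneous_def using h(1) MD.component_mem[OF below_carrier[OF x(1)] h(1)] by auto
    show "?y \<in> below i"
      using below_component[OF x(1) h(1)] .
    fix z assume "z \<in> below i"
    then have "\<phi> i z \<in> {c \<otimes>\<^bsub>R\<^esub> a | c. c \<in> carrier R}"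
      unfolding J[symmetric] by simp
    then show "\<exists>c\<in>carrier R. \<phi> i z = c \<otimes>\<^bsub>R\<^esub> \<phi> i ?y"
      unfolding y by auto
  qed
qed

definition lead :: "'i \<Rightarrow> 'm" where
  "lead i = (SOME x. x \<in> homogeneous G \<M> \<inter> below i \<and> \<phi> i x \<in> homogeneous G \<R> \<and>
     (\<forall>y\<in>below i. \<exists>c\<in>carrier R. \<phi> i y = c \<otimes>\<^bsub>R\<^esub> \<phi> i x))"

lemma
  assumes "i \<in> I"
  shows lead_homogeneous: "lead i \<in> homogeneous G \<M>"
    and lead_below: "lead i \<in> below i"
    and lead_coord_homogeneous: "\<phi> i (lead i) \<in> homogeneous G \<R>"
    and lead_generates: "y \<in> below i \<Longrightarrow> \<exists>c\<in>carrier R. \<phi> i y = c \<otimes>\<^bsub>R\<^esub> \<phi> i (lead i)"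
proof -
  have "\<exists>x. x \<in> homogeneous G \<M> \<inter> below i \<and> \<phi> i x \<in> homogeneous G \<R> \<and>
     (\<forall>y\<in>below i. \<exists>c\<in>carrier R. \<phi> i y = c \<otimes>\<^bsub>R\<^esub> \<phi> i x)"
    using leading_element[OF assms] by blast
  from someI_ex[OF this] have *: "lead i \<in> homogeneous G \<M> \<inter> below i \<and> \<phi> i (lead i) \<in> homogeneous G \<R> \<and>
     (\<forall>y\<in>below i. \<exists>c\<in>carrier R. \<phi> i y = c \<otimes>\<^bsub>R\<^esub> \<phi> i (lead i))"
    unfolding lead_def .
  then show "lead i \<in> homogeneous G \<M>" "lead i \<in> below i" "\<phi> i (lead i) \<in> homogeneous G \<R>"
    "y \<in> below i \<Longrightarrow> \<exists>c\<in>carrier R. \<phi> i y = c \<otimes>\<^bsub>R\<^esub> \<phi> i (lead i)" by auto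
qed

lemma lead_coord_zero: "i \<in> I \<Longrightarrow> j \<in> I \<Longrightarrow> i \<prec> j \<Longrightarrow> \<phi> j (lead i) = \<zero>\<^bsub>R\<^esub>"
  using lead_below by (simp add: below_def)

definition lead_indices :: "'i set" where
  "lead_indices = {i \<in> I. \<phi> i (lead i) \<noteq> \<zero>\<^bsub>R\<^esub>}"

lemma lead_carrier: "i \<in> I \<Longrightarrow> lead i \<in> carrier M"
  using lead_below below_carrier by auto

lemma lead_subset: "lead ` lead_indices \<subseteq> carrier M"
  using lead_carrier by (auto simp: lead_indices_def)

lemma inj_lead: "inj_on lead lead_indices"
proof (rule inj_onI, rule ccontr)
  fix i j assume *: "i \<in> lead_indices" "j \<in> lead_indices" "lead i = lead j" "i \<noteq> j"
  then consider "i \<prec> j" | "j \<prec> i" using total by auto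
  then show False
    using * lead_coord_zero[of i j] lead_coord_zero[of j i] by cases (auto simp: lead_indices_def)
qed

lemma finite_greatest:
  assumes "finite A" "A \<noteq> {}"
  obtains m where "m \<in> A" "\<And>j. j \<in> A \<Longrightarrow> \<not> m \<prec> j"
proof -
  have "\<exists>m\<in>A. \<forall>x\<in>A. x \<noteq> m \<longrightarrow> \<not> m \<prec> x"
    using assms trans asym
    by (intro Finite_Set.bex_max_element) (auto simp: asymp_on_def intro: transp_on_subset)
  then show thesis
    using that irrefl by metis
qed

lemma leading_index:
  assumes "x \<in> carrier M" "x \<noteq> \<zero>\<^bsub>M\<^esub>"
  obtains m where "m \<in> I" "\<phi> m x \<noteq> \<zero>\<^bsub>R\<^esub>" "x \<in> below m"
proof -
  have "{j \<in> I. \<phi> j x \<noteq> \<zero>\<^bsub>R\<^esub>} \<noteq> {}"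
    using coord_inj[OF assms(1)] assms(2) by auto
  then obtain m where "m \<in> {j \<in> I. \<phi> j x \<noteq> \<zero>\<^bsub>R\<^esub>}"
      "\<And>j. j \<in> {j \<in> I. \<phi> j x \<noteq> \<zero>\<^bsub>R\<^esub>} \<Longrightarrow> \<not> m \<prec> j"
    using finite_greatest[OF finite_coord[OF assms(1)]] by blast
  then show thesis
    using assms(1) by (intro that[of m]) (auto simp: below_def)
qed

text \<open>
  Subtracting a suitable multiple of \<open>lead i\<close> cancels the coordinate at \<open>i\<close>; what remains vanishes or
  has a smaller leading index, which is covered by the induction hypothesis.
\<close>
lemma below_generated:
  assumes "i \<in> I" "y \<in> below i"
  shows "y \<in> lin_span (lead ` lead_indices)"
  using wf assms
proof (induction i arbitrary: y rule: wfp_induct_rule)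
  case (less i)
  note i = \<open>i \<in> I\<close> and yc = below_carrier[OF \<open>y \<in> below i\<close>]
  have lc: "lead i \<in> carrier M"
    using lead_carrier[OF i] .
  note f = coord[OF i]
  obtain b where b: "b \<in> carrier R" "\<phi> i y = b \<otimes>\<^bsub>R\<^esub> \<phi> i (lead i)"
    using lead_generates[OF i \<open>y \<in> below i\<close>] by auto
  \<comment> \<open>If the leading coefficient is zero, then \<open>lead i\<close> is not among the chosen generators and the
      coordinate at \<open>i\<close> is zero already, so nothing is subtracted.\<close>
  define c where "c = (if i \<in> lead_indices then b else \<zero>\<^bsub>R\<^esub>)"
  have c: "c \<in> carrier R" "\<phi> i y = c \<otimes>\<^bsub>R\<^esub> \<phi> i (lead i)"
    using b i by (auto simp: c_def lead_indices_def)
  define z where "z = y \<oplus>\<^bsub>M\<^esub> \<ominus>\<^bsub>M\<^esub> (c \<odot>\<^bsub>M\<^esub> lead i)"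
  have z: "z \<in> below i"
    unfolding z_def using \<open>y \<in> below i\<close> lead_below[OF i] c(1)
    by (intro below_add below_minus below_smult)
  then have zc: "z \<in> carrier M"
    by (rule below_carrier)
  have "\<phi> i z = \<zero>\<^bsub>R\<^esub>"
    unfolding z_def using f c yc lc
    by (simp add: functional_add functional_minus functional_smult functional_closed R.r_neg)
  have "z \<in> lin_span (lead ` lead_indices)"
  proof (cases "z = \<zero>\<^bsub>M\<^esub>")
    case True
    then show ?thesis
      using lin_span_zero by simp
  next
    case False
    obtain m where m: "m \<in> I" "\<phi> m z \<noteq> \<zero>\<^bsub>R\<^esub>" "z \<in> below m"
      using leading_index[OF zc False] .
    have "m \<noteq> i" "\<not> i \<prec> m"
      using m(1,2) z \<open>\<phi> i z = \<zero>\<^bsub>R\<^esub>\<close> by (auto simp: below_def)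
    then have "m \<prec> i"
      using total by blast
    then show ?thesis
      using less.IH m(1,3) by simp
  qed
  moreover have "c \<odot>\<^bsub>M\<^esub> lead i \<in> lin_span (lead ` lead_indices)"
  proof (cases "i \<in> lead_indices")
    case True
    then show ?thesis
      using lc c(1) by (intro lin_span_base) simp_all
  next
    case False
    then show ?thesis
      using lin_span_zero lc by (simp add: c_def)
  qed
  moreover have "y = z \<oplus>\<^bsub>M\<^esub> c \<odot>\<^bsub>M\<^esub> lead i"
    unfolding z_def using yc lc c(1) by (simp add: M.a_assoc M.l_neg)
  ultimately show ?case
    using lin_span_add[OF lead_subset] by simp
qed

lemma generated:
  assumes "x \<in> carrier M"
  shows "x \<in> lin_span (lead ` lead_indices)"
proof (cases "x = \<zero>\<^bsub>M\<^esub>")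
  case True
  then show ?thesis
    using lin_span_zero by simp
next
  case False
  obtain m where "m \<in> I" "\<phi> m x \<noteq> \<zero>\<^bsub>R\<^esub>" "x \<in> below m"
    using leading_index[OF assms False] .
  from this(1,3) show ?thesis
    by (rule below_generated)
qed

text \<open>
  In a nontrivial relation let \<open>m\<close> be the greatest index with nonzero coefficient. All other terms
  vanish at the coordinate \<open>m\<close>, so the product of that coefficient with the leading coefficient of
  \<open>lead m\<close> is zero; but the latter is homogeneous and nonzero, hence a non-zerodivisor.
\<close>
lemma independent:
  assumes F: "finite F" "F \<subseteq> lead ` lead_indices" and c: "c \<in> F \<rightarrow> carrier R"
    and sum: "(\<Oplus>\<^bsub>M\<^esub>b\<in>F. c b \<odot>\<^bsub>M\<^esub> b) = \<zero>\<^bsub>M\<^esub>"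
  shows "\<forall>b\<in>F. c b = \<zero>\<^bsub>R\<^esub>"
proof (rule ccontr)
  assume "\<not> (\<forall>b\<in>F. c b = \<zero>\<^bsub>R\<^esub>)"
  then obtain b0 where b0: "b0 \<in> F" "c b0 \<noteq> \<zero>\<^bsub>R\<^esub>" by auto
  define A where "A = {i \<in> lead_indices. lead i \<in> F \<and> c (lead i) \<noteq> \<zero>\<^bsub>R\<^esub>}"
  have "finite A"
    using F(1) inj_lead by (auto simp: A_def intro!: finite_imageD[of lead] intro: finite_subset inj_on_subset)
  moreover have "A \<noteq> {}"
    using b0 F(2) by (auto simp: A_def)
  ultimately obtain m where m: "m \<in> A" "\<And>j. j \<in> A \<Longrightarrow> \<not> m \<prec> j"
    using finite_greatest by blast
  then have mI: "m \<in> I" and ml: "m \<in> lead_indices" "lead m \<in> F" "c (lead m) \<noteq> \<zero>\<^bsub>R\<^esub>"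
    by (auto simp: A_def lead_indices_def)
  note f = coord[OF mI]
  have Fc: "F \<subseteq> carrier M"
    using F(2) lead_subset by auto
  have term0: "c b \<otimes>\<^bsub>R\<^esub> \<phi> m b = \<zero>\<^bsub>R\<^esub>" if b: "b \<in> F" "b \<noteq> lead m" for b
  proof -
    obtain j where j: "j \<in> lead_indices" "b = lead j"
      using F(2) b(1) by auto
    then have "j \<in> I" "j \<noteq> m"
      using b(2) by (auto simp: lead_indices_def)
    then consider "j \<prec> m" | "m \<prec> j"
      using total by blast
    then show ?thesis
    proof cases
      case 1
      then show ?thesis
        using lead_coord_zero[OF \<open>j \<in> I\<close> mI] j(2) c b(1) by (auto dest: Pi_mem)
    next
      case 2
      then have "j \<notin> A"
        using m(2) by blast
      then have "c b = \<zero>\<^bsub>R\<^esub>"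
        using j b(1) by (auto simp: A_def)
      then show ?thesis
        using functional_closed[OF f] b(1) Fc by auto
    qed
  qed
  have cl: "c b \<otimes>\<^bsub>R\<^esub> \<phi> m b \<in> carrier R" if "b \<in> F" for b
    using that c Fc functional_closed[OF f, of b] by (auto dest: Pi_mem)
  have "\<zero>\<^bsub>R\<^esub> = \<phi> m (\<Oplus>\<^bsub>M\<^esub>b\<in>F. c b \<odot>\<^bsub>M\<^esub> b)"
    using sum functional_zero[OF f] by simp
  also have "\<dots> = (\<Oplus>\<^bsub>R\<^esub>b\<in>F. \<phi> m (c b \<odot>\<^bsub>M\<^esub> b))"
    using c Fc by (intro abelian_group_hom.hom_finsum functional_hom f) (auto dest: Pi_mem)
  also have "\<dots> = (\<Oplus>\<^bsub>R\<^esub>b\<in>F. if b = lead m then c b \<otimes>\<^bsub>R\<^esub> \<phi> m b else \<zero>\<^bsub>R\<^esub>)"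
  proof (intro R.finsum_cong')
    fix b assume b: "b \<in> F"
    have "\<phi> m (c b \<odot>\<^bsub>M\<^esub> b) = c b \<otimes>\<^bsub>R\<^esub> \<phi> m b"
      using functional_smult[OF f Pi_mem[OF c b]] b Fc by auto
    then show "\<phi> m (c b \<odot>\<^bsub>M\<^esub> b) = (if b = lead m then c b \<otimes>\<^bsub>R\<^esub> \<phi> m b else \<zero>\<^bsub>R\<^esub>)"
      using term0[OF b] by simp
  qed (use cl in auto)
  also have "\<dots> = c (lead m) \<otimes>\<^bsub>R\<^esub> \<phi> m (lead m)"
    using cl by (intro R.add.finprod_singleton_swap ml(2) F(1)) auto
  finally have "\<phi> m (lead m) \<otimes>\<^bsub>R\<^esub> c (lead m) = \<zero>\<^bsub>R\<^esub>"
    using R.m_comm functional_closed[OF f lead_carrier[OF mI]] Pi_mem[OF c ml(2)] by simp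
  moreover have "\<phi> m (lead m) \<noteq> \<zero>\<^bsub>R\<^esub>"
    using ml(1) by (simp add: lead_indices_def)
  ultimately have "c (lead m) = \<zero>\<^bsub>R\<^esub>"
    using principal lead_coord_homogeneous[OF mI] Pi_mem[OF c ml(2)]
    by (auto simp: graded_principal_def graded_entire_def)
  then show False
    using ml(3) by simp
qed

theorem free: "graded_free G R M \<M>"
  unfolding graded_free_def module_basis_def
proof (rule exI[of _ "lead ` lead_indices"], intro conjI ballI allI impI)
  show "lead ` lead_indices \<subseteq> homogeneous G \<M>"
    using lead_homogeneous by (auto simp: lead_indices_def)
  show "lead ` lead_indices \<subseteq> carrier M"
    using lead_subset .
  show "\<exists>F c. finite F \<and> F \<subseteq> lead ` lead_indices \<and> c \<in> F \<rightarrow> carrier R \<and> x = (\<Oplus>\<^bsub>M\<^esub>b\<in>F. c b \<odot>\<^bsub>M\<^esub> b)"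
    if "x \<in> carrier M" for x
    using generated[OF that] by (simp add: lin_span_def)
  show "c b = \<zero>\<^bsub>R\<^esub>"
    if "finite F" "F \<subseteq> lead ` lead_indices" "c \<in> F \<rightarrow> carrier R"
      "(\<Oplus>\<^bsub>M\<^esub>b\<in>F. c b \<odot>\<^bsub>M\<^esub> b) = \<zero>\<^bsub>M\<^esub>" "b \<in> F" for F c b
    using independent[OF that(1-4)] that(5) by blast
qed

end

section \<open>Homogeneous parts of linear functionals\<close>

lemma ex_well_order: "\<exists>r :: 'i \<Rightarrow> 'i \<Rightarrow> bool. wfp r \<and> transp r \<and> (\<forall>i j. i \<noteq> j \<longrightarrow> r i j \<or> r j i)"
proof -
  obtain r :: "'i rel" where r: "Well_order r" "Field r = UNIV"
    using well_ordering by metis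
  then have r': "well_order_on UNIV r" by simp
  have wf: "wf (r - Id)"
    using r' unfolding well_order_on_def by blast
  have lin: "linear_order_on UNIV r"
    using r' unfolding well_order_on_def by blast
  have tr: "trans (r - Id)"
    using lin unfolding linear_order_on_def partial_order_on_def preorder_on_def
    by (blast intro: trans_diff_Id)
  have tot: "(i, j) \<in> r \<or> (j, i) \<in> r" if "i \<noteq> j" for i j
    using lin that unfolding linear_order_on_def total_on_def by blast
  show ?thesis
  proof (intro exI[of _ "\<lambda>i j. (i, j) \<in> r - Id"] conjI allI impI)
    show "wfp (\<lambda>i j. (i, j) \<in> r - Id)"
      unfolding wfp_def by (rule wf_subset[OF wf]) auto
    show "transp (\<lambda>i j. (i, j) \<in> r - Id)"
      using tr unfolding transp_def trans_def by blast
    show "(i, j) \<in> r - Id \<or> (j, i) \<in> r - Id" if "i \<noteq> j" for i j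
      using tot that by simp
  qed
qed

context graded_mod
begin

lemma component_zero: "RD.component \<zero>\<^bsub>R\<^esub> i = \<zero>\<^bsub>R\<^esub>" "MD.component \<zero>\<^bsub>M\<^esub> i = \<zero>\<^bsub>M\<^esub>"
  by (rule abelian_group_hom.hom_zero, rule RD.component_hom)
    (rule abelian_group_hom.hom_zero, rule MD.component_hom)

lemma component_mult:
  assumes g: "g \<in> carrier G" "a \<in> \<R> g" and h: "h \<in> carrier G" and b: "b \<in> carrier R"
  shows "RD.component (a \<otimes>\<^bsub>R\<^esub> b) (g \<otimes>\<^bsub>G\<^esub> h) = a \<otimes>\<^bsub>R\<^esub> RD.component b h"
  using b
proof (induction b rule: RD.homogeneous_induct)
  case zero
  then show ?case
    using RD.summand_closed[OF g] by (simp add: component_zero)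
next
  case (homog k b)
  have "g \<otimes>\<^bsub>G\<^esub> h = g \<otimes>\<^bsub>G\<^esub> k \<longleftrightarrow> h = k"
    using g(1) h homog(1) by simp
  then show ?case
    using RD.component_homogeneous[OF _ ring_mult_mem[OF g(1) homog(1) g(2) homog(2)], of "g \<otimes>\<^bsub>G\<^esub> h"]
      RD.component_homogeneous[OF homog, of h] g(1) homog(1) RD.summand_closed[OF g] by simp
next
  case (add x y)
  then show ?case
    using RD.summand_closed[OF g] by (simp add: R.r_distr RD.component_add)
qed

text \<open>
  For \<open>x\<close> of degree \<open>k\<close> it is the component of
  \<open>f x\<close> of degree \<open>k - g\<close>, in additive notation; thus \<open>degree_part f g\<close> lowers degrees by \<open>g\<close>.
\<close>
definition degree_part :: "('m \<Rightarrow> 'r) \<Rightarrow> 'g \<Rightarrow> 'm \<Rightarrow> 'r" where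
  "degree_part f g x =
     (\<Oplus>\<^bsub>R\<^esub>k\<in>{k. MD.component x k \<noteq> \<zero>\<^bsub>M\<^esub>}. RD.component (f (MD.component x k)) (k \<otimes>\<^bsub>G\<^esub> inv\<^bsub>G\<^esub> g))"

context
  fixes f assumes f: "functional R M f"
begin

lemma degree_part_superset:
  assumes x: "x \<in> carrier M" and F: "finite F" "{k. MD.component x k \<noteq> \<zero>\<^bsub>M\<^esub>} \<subseteq> F"
  shows "degree_part f g x = (\<Oplus>\<^bsub>R\<^esub>k\<in>F. RD.component (f (MD.component x k)) (k \<otimes>\<^bsub>G\<^esub> inv\<^bsub>G\<^esub> g))"
  unfolding degree_part_def
  using x F functional_closed[OF f] functional_zero[OF f] component_zero
  by (intro R.add.finprod_mono_neutral_cong_left Pi_I RD.component_closed) auto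

lemma degree_part_homogeneous:
  assumes k: "k \<in> carrier G" "x \<in> \<M> k"
  shows "degree_part f g x = RD.component (f x) (k \<otimes>\<^bsub>G\<^esub> inv\<^bsub>G\<^esub> g)"
proof -
  have x: "x \<in> carrier M"
    using MD.summand_closed[OF k] .
  have "degree_part f g x = (\<Oplus>\<^bsub>R\<^esub>l\<in>{k}. RD.component (f (MD.component x l)) (l \<otimes>\<^bsub>G\<^esub> inv\<^bsub>G\<^esub> g))"
    using MD.component_homogeneous[OF k] by (intro degree_part_superset x) (auto split: if_splits)
  also have "\<dots> = RD.component (f x) (k \<otimes>\<^bsub>G\<^esub> inv\<^bsub>G\<^esub> g)"
    using MD.component_homogeneous[OF k, of k] functional_closed[OF f x] by simp
  finally show ?thesis .
qed

lemma degree_part_zero: "degree_part f g \<zero>\<^bsub>M\<^esub> = \<zero>\<^bsub>R\<^esub>"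
  by (simp add: degree_part_def component_zero)

lemma degree_part_closed: "x \<in> carrier M \<Longrightarrow> degree_part f g x \<in> carrier R"
  unfolding degree_part_def
  by (intro R.finsum_closed Pi_I RD.component_closed functional_closed[OF f] MD.component_closed)

lemma degree_part_add:
  assumes x: "x \<in> carrier M" and y: "y \<in> carrier M"
  shows "degree_part f g (x \<oplus>\<^bsub>M\<^esub> y) = degree_part f g x \<oplus>\<^bsub>R\<^esub> degree_part f g y"
proof -
  let ?F = "{k. MD.component x k \<noteq> \<zero>\<^bsub>M\<^esub>} \<union> {k. MD.component y k \<noteq> \<zero>\<^bsub>M\<^esub>}"
  let ?t = "\<lambda>z k. RD.component (f (MD.component z k)) (k \<otimes>\<^bsub>G\<^esub> inv\<^bsub>G\<^esub> g)"
  have F: "finite ?F"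
    using MD.finite_component x y by simp
  have t: "?t z \<in> ?F \<rightarrow> carrier R" if "z \<in> carrier M" for z
    using that by (intro Pi_I RD.component_closed functional_closed[OF f] MD.component_closed)
  have "degree_part f g (x \<oplus>\<^bsub>M\<^esub> y) = (\<Oplus>\<^bsub>R\<^esub>k\<in>?F. ?t (x \<oplus>\<^bsub>M\<^esub> y) k)"
    using x y by (intro degree_part_superset F) (auto simp: MD.component_add)
  also have "\<dots> = (\<Oplus>\<^bsub>R\<^esub>k\<in>?F. ?t x k \<oplus>\<^bsub>R\<^esub> ?t y k)"
    using x y functional_closed[OF f]
    by (simp add: MD.component_add functional_add[OF f] RD.component_add)
  also have "\<dots> = (\<Oplus>\<^bsub>R\<^esub>k\<in>?F. ?t x k) \<oplus>\<^bsub>R\<^esub> (\<Oplus>\<^bsub>R\<^esub>k\<in>?F. ?t y k)"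
    by (intro R.finsum_addf t x y)
  also have "\<dots> = degree_part f g x \<oplus>\<^bsub>R\<^esub> degree_part f g y"
    using degree_part_superset[OF x F, of g] degree_part_superset[OF y F, of g] by simp
  finally show ?thesis .
qed

text \<open>
  By additivity in both arguments only homogeneous \<open>a\<close> and \<open>x\<close> matter, and there the statement is
  that multiplication by \<open>a\<close> translates components.
\<close>
lemma degree_part_smult:
  assumes g: "g \<in> carrier G" and a: "a \<in> carrier R" and x: "x \<in> carrier M"
  shows "degree_part f g (a \<odot>\<^bsub>M\<^esub> x) = a \<otimes>\<^bsub>R\<^esub> degree_part f g x"
  using x
proof (induction x rule: MD.homogeneous_induct)
  case zero
  then show ?case using a by (simp add: degree_part_zero)
next
  case (add x y)
  then show ?case
    using a by (simp add: degree_part_add degree_part_closed smult_r_distr R.r_distr)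
next
  case (homog k x)
  have x: "x \<in> carrier M"
    using MD.summand_closed[OF homog] .
  show ?case
    using a
  proof (induction a rule: RD.homogeneous_induct)
    case zero
    then show ?case using x degree_part_closed[OF x] by (simp add: degree_part_zero)
  next
    case (add a b)
    then show ?case
      using x degree_part_closed[OF x]
      by (simp add: degree_part_add smult_l_distr R.l_distr)
  next
    case (homog l a)
    note k = \<open>k \<in> carrier G\<close> \<open>x \<in> \<M> k\<close>
    have a: "a \<in> carrier R"
      using RD.summand_closed[OF homog] .
    have "degree_part f g (a \<odot>\<^bsub>M\<^esub> x) = RD.component (f (a \<odot>\<^bsub>M\<^esub> x)) ((l \<otimes>\<^bsub>G\<^esub> k) \<otimes>\<^bsub>G\<^esub> inv\<^bsub>G\<^esub> g)"
      by (rule degree_part_homogeneous[OF _ smult_mem[OF homog(1) k(1) homog(2) k(2)]])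
        (simp add: homog(1) k(1))
    also have "\<dots> = RD.component (a \<otimes>\<^bsub>R\<^esub> f x) (l \<otimes>\<^bsub>G\<^esub> (k \<otimes>\<^bsub>G\<^esub> inv\<^bsub>G\<^esub> g))"
      using functional_smult[OF f a x] homog(1) k(1) g by (simp add: G.m_assoc)
    also have "\<dots> = a \<otimes>\<^bsub>R\<^esub> RD.component (f x) (k \<otimes>\<^bsub>G\<^esub> inv\<^bsub>G\<^esub> g)"
      using k(1) g functional_closed[OF f x] by (intro component_mult homog) simp_all
    also have "\<dots> = a \<otimes>\<^bsub>R\<^esub> degree_part f g x"
      using degree_part_homogeneous[OF k] by simp
    finally show ?case .
  qed
qed

lemma degree_part_functional:
  assumes "g \<in> carrier G"
  shows "functional R M (degree_part f g)"
  unfolding functional_def using assms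
  by (intro conjI ballI abelian_group_homI M.abelian_group_axioms R.abelian_group_axioms)
    (simp_all add: degree_part_closed degree_part_add degree_part_smult)

lemma degree_part_mem:
  assumes "g \<in> carrier G" "k \<in> carrier G" "x \<in> \<M> k"
  shows "degree_part f g x \<in> \<R> (k \<otimes>\<^bsub>G\<^esub> inv\<^bsub>G\<^esub> g)"
  unfolding degree_part_homogeneous[OF assms(2,3)] using assms(1,2)
  by (intro RD.component_mem functional_closed[OF f] MD.summand_closed[OF assms(2,3)]) simp

end

text \<open>
  The parts of the \<open>\<phi> i\<close>, indexed by pairs \<open>(i, g)\<close>, are homogeneous coordinates. For fixed \<open>x\<close> only
  finitely many components of \<open>x\<close> matter, each has finitely many nonzero coordinates, and each of
  these has finitely many nonzero components, so the family is pointwise finite. It is jointly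
  injective since every component of every \<open>\<phi> i y\<close>, for \<open>y\<close> a component of \<open>x\<close>, occurs among its values
  on \<open>y\<close>.
\<close>
theorem free_of_coordinates:
  fixes \<phi> :: "'i \<Rightarrow> 'm \<Rightarrow> 'r"
  assumes principal: "graded_principal G R \<R>"
    and coord: "\<And>i. i \<in> I \<Longrightarrow> functional R M (\<phi> i)"
    and fin: "\<And>x. x \<in> carrier M \<Longrightarrow> finite {i \<in> I. \<phi> i x \<noteq> \<zero>\<^bsub>R\<^esub>}"
    and inj: "\<And>x. x \<in> carrier M \<Longrightarrow> (\<And>i. i \<in> I \<Longrightarrow> \<phi> i x = \<zero>\<^bsub>R\<^esub>) \<Longrightarrow> x = \<zero>\<^bsub>M\<^esub>"
  shows "graded_free G R M \<M>"
proof -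
  let ?\<phi> = "\<lambda>p. degree_part (\<phi> (fst p)) (snd p)"
  let ?I = "I \<times> carrier G"
  have finite: "finite {p \<in> ?I. ?\<phi> p x \<noteq> \<zero>\<^bsub>R\<^esub>}" if x: "x \<in> carrier M" for x
  proof -
    let ?K = "{k. MD.component x k \<noteq> \<zero>\<^bsub>M\<^esub>}"
    let ?S = "\<lambda>k. SIGMA i:{i \<in> I. \<phi> i (MD.component x k) \<noteq> \<zero>\<^bsub>R\<^esub>}. {h. RD.component (\<phi> i (MD.component x k)) h \<noteq> \<zero>\<^bsub>R\<^esub>}"
    have "{p \<in> ?I. ?\<phi> p x \<noteq> \<zero>\<^bsub>R\<^esub>} \<subseteq> (\<Union>k\<in>?K. (\<lambda>(i, h). (i, inv\<^bsub>G\<^esub> h \<otimes>\<^bsub>G\<^esub> k)) ` ?S k)"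
    proof (rule subsetI)
      fix p assume p: "p \<in> {p \<in> ?I. ?\<phi> p x \<noteq> \<zero>\<^bsub>R\<^esub>}"
      obtain i g where ig: "p = (i, g)" by (cases p)
      then have i: "i \<in> I" and g: "g \<in> carrier G" and nz: "degree_part (\<phi> i) g x \<noteq> \<zero>\<^bsub>R\<^esub>"
        using p by auto
      obtain k where k: "k \<in> ?K" "RD.component (\<phi> i (MD.component x k)) (k \<otimes>\<^bsub>G\<^esub> inv\<^bsub>G\<^esub> g) \<noteq> \<zero>\<^bsub>R\<^esub>"
      proof (rule ccontr)
        assume "\<not> thesis"
        then have "degree_part (\<phi> i) g x = \<zero>\<^bsub>R\<^esub>"
          unfolding degree_part_def using that by (intro R.add.finprod_one_eqI) blast
        with nz show False ..
      qed
      have kG: "k \<in> carrier G"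
        using MD.component_support[OF x] k(1) by auto
      have "\<phi> i (MD.component x k) \<noteq> \<zero>\<^bsub>R\<^esub>"
        using k(2) component_zero by auto
      then have "(i, k \<otimes>\<^bsub>G\<^esub> inv\<^bsub>G\<^esub> g) \<in> ?S k"
        using i k(2) by simp
      moreover have "p = (\<lambda>(i, h). (i, inv\<^bsub>G\<^esub> h \<otimes>\<^bsub>G\<^esub> k)) (i, k \<otimes>\<^bsub>G\<^esub> inv\<^bsub>G\<^esub> g)"
        using g kG by (simp add: ig G.inv_mult_group G.m_assoc)
      ultimately show "p \<in> (\<Union>k\<in>?K. (\<lambda>(i, h). (i, inv\<^bsub>G\<^esub> h \<otimes>\<^bsub>G\<^esub> k)) ` ?S k)"
        using k(1) by blast
    qed
    moreover have "finite (?S k)" for k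
      using x fin RD.finite_component functional_closed[OF coord] by (intro finite_SigmaI) auto
    ultimately show ?thesis
      using MD.finite_component[OF x] by (auto intro: finite_subset)
  qed
  have zero: "x = \<zero>\<^bsub>M\<^esub>" if x: "x \<in> carrier M" and z: "\<And>p. p \<in> ?I \<Longrightarrow> ?\<phi> p x = \<zero>\<^bsub>R\<^esub>" for x
  proof (rule MD.component_eq_zero[OF x])
    fix k assume k: "k \<in> carrier G"
    show "MD.component x k = \<zero>\<^bsub>M\<^esub>"
    proof (rule inj[OF MD.component_closed[OF x]])
      fix i assume i: "i \<in> I"
      note f = coord[OF i]
      show "\<phi> i (MD.component x k) = \<zero>\<^bsub>R\<^esub>"
      proof (rule RD.component_eq_zero)
        show "\<phi> i (MD.component x k) \<in> carrier R"
          using functional_closed[OF f MD.component_closed[OF x]] .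
        fix h assume h: "h \<in> carrier G"
        \<comment> \<open>The degree for which \<open>degree_part\<close> reads off the component of degree \<open>h\<close> at arguments of
            degree \<open>k\<close>.\<close>
        define g where "g = inv\<^bsub>G\<^esub> h \<otimes>\<^bsub>G\<^esub> k"
        have g: "g \<in> carrier G" "k \<otimes>\<^bsub>G\<^esub> inv\<^bsub>G\<^esub> g = h"
          using h k by (simp_all add: g_def G.inv_mult_group G.m_assoc[symmetric])
        have "RD.component (degree_part (\<phi> i) g x) (k \<otimes>\<^bsub>G\<^esub> inv\<^bsub>G\<^esub> g) = degree_part (\<phi> i) g (MD.component x k)"
          using degree_part_functional[OF f g(1)] g(1) degree_part_mem[OF f g(1)] k x
          by (rule component_functional)
        moreover have "degree_part (\<phi> i) g x = \<zero>\<^bsub>R\<^esub>"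
          using z[of "(i, g)"] i g(1) by simp
        ultimately show "RD.component (\<phi> i (MD.component x k)) h = \<zero>\<^bsub>R\<^esub>"
          using degree_part_homogeneous[OF f k MD.component_mem[OF x k], of g] g(2) component_zero by simp
      qed
    qed
  qed
  obtain less :: "'i \<times> 'g \<Rightarrow> 'i \<times> 'g \<Rightarrow> bool"
    where less: "wfp less \<and> transp less \<and> (\<forall>i j. i \<noteq> j \<longrightarrow> less i j \<or> less j i)"
    using ex_well_order ..
  interpret homogeneous_coordinates G R \<R> M \<M> ?\<phi> ?I snd less
  proof unfold_locales
    fix p assume p: "p \<in> ?I"
    show "functional R M (?\<phi> p)" "snd p \<in> carrier G"
      using p degree_part_functional[OF coord] by auto
    show "?\<phi> p x \<in> \<R> (k \<otimes>\<^bsub>G\<^esub> inv\<^bsub>G\<^esub> snd p)" if "k \<in> carrier G" "x \<in> \<M> k" for k x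
      using p that by (intro degree_part_mem coord) auto
  qed (use principal finite zero less in blast)+
  show ?thesis
    by (rule free)
qed

end

section \<open>Free modules of finitely supported families\<close>

text \<open>
  Families are total functions that vanish outside \<open>\<Gamma>\<close>, so that equality in the module is equality of
  functions. The record of a module extends that of a ring, hence the undefined multiplication.
\<close>
definition free_module :: "('r, 'c) ring_scheme \<Rightarrow> 'i set \<Rightarrow> ('r, 'i \<Rightarrow> 'r) module" where
  "free_module R \<Gamma> =
     \<lparr>carrier = {c. (\<forall>i. c i \<in> carrier R) \<and> (\<forall>i. i \<notin> \<Gamma> \<longrightarrow> c i = \<zero>\<^bsub>R\<^esub>) \<and> finite {i. c i \<noteq> \<zero>\<^bsub>R\<^esub>}},
      mult = undefined, one = undefined, zero = (\<lambda>i. \<zero>\<^bsub>R\<^esub>), add = (\<lambda>c c' i. c i \<oplus>\<^bsub>R\<^esub> c' i),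
      smult = (\<lambda>a c i. a \<otimes>\<^bsub>R\<^esub> c i)\<rparr>"

lemma free_module_simps [simp]:
  "\<zero>\<^bsub>free_module R \<Gamma>\<^esub> = (\<lambda>i. \<zero>\<^bsub>R\<^esub>)"
  "c \<oplus>\<^bsub>free_module R \<Gamma>\<^esub> c' = (\<lambda>i. c i \<oplus>\<^bsub>R\<^esub> c' i)"
  "a \<odot>\<^bsub>free_module R \<Gamma>\<^esub> c = (\<lambda>i. a \<otimes>\<^bsub>R\<^esub> c i)"
  by (simp_all add: free_module_def)

lemma free_module_carrier:
  "c \<in> carrier (free_module R \<Gamma>) \<longleftrightarrow>
     (\<forall>i. c i \<in> carrier R) \<and> (\<forall>i. i \<notin> \<Gamma> \<longrightarrow> c i = \<zero>\<^bsub>R\<^esub>) \<and> finite {i. c i \<noteq> \<zero>\<^bsub>R\<^esub>}"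
  by (simp add: free_module_def)

lemma free_module_zeroI:
  "c \<in> carrier (free_module R \<Gamma>) \<Longrightarrow> (\<And>i. i \<in> \<Gamma> \<Longrightarrow> c i = \<zero>\<^bsub>R\<^esub>) \<Longrightarrow> c = \<zero>\<^bsub>free_module R \<Gamma>\<^esub>"
  by (auto simp: free_module_carrier)

context cring
begin

lemma free_module_add_closed:
  assumes "c \<in> carrier (free_module R \<Gamma>)" "c' \<in> carrier (free_module R \<Gamma>)"
  shows "(\<lambda>i. c i \<oplus> c' i) \<in> carrier (free_module R \<Gamma>)"
proof -
  have "{i. c i \<oplus> c' i \<noteq> \<zero>} \<subseteq> {i. c i \<noteq> \<zero>} \<union> {i. c' i \<noteq> \<zero>}"
    by auto
  then have "finite {i. c i \<oplus> c' i \<noteq> \<zero>}"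
    using assms by (auto simp: free_module_carrier intro: finite_subset)
  then show ?thesis
    using assms by (simp add: free_module_carrier)
qed

lemma free_module_smult_closed:
  assumes "a \<in> carrier R" "c \<in> carrier (free_module R \<Gamma>)"
  shows "(\<lambda>i. a \<otimes> c i) \<in> carrier (free_module R \<Gamma>)"
proof -
  have "{i. a \<otimes> c i \<noteq> \<zero>} \<subseteq> {i. c i \<noteq> \<zero>}"
    using assms(1) by auto
  then have "finite {i. a \<otimes> c i \<noteq> \<zero>}"
    using assms(2) by (auto simp: free_module_carrier intro: finite_subset)
  then show ?thesis
    using assms by (simp add: free_module_carrier)
qed

lemma free_module_module: "module R (free_module R \<Gamma>)"
proof (rule moduleI)
  show "cring R" by (rule is_cring)
  show "abelian_group (free_module R \<Gamma>)"
  proof (rule abelian_groupI)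
    fix c assume c: "c \<in> carrier (free_module R \<Gamma>)"
    then have "(\<lambda>i. \<ominus> \<one> \<otimes> c i) \<in> carrier (free_module R \<Gamma>)"
      by (intro free_module_smult_closed) simp_all
    moreover have "(\<lambda>i. \<ominus> \<one> \<otimes> c i) \<oplus>\<^bsub>free_module R \<Gamma>\<^esub> c = \<zero>\<^bsub>free_module R \<Gamma>\<^esub>"
      using c by (auto simp: free_module_carrier l_minus l_neg)
    ultimately show "\<exists>c'\<in>carrier (free_module R \<Gamma>). c' \<oplus>\<^bsub>free_module R \<Gamma>\<^esub> c = \<zero>\<^bsub>free_module R \<Gamma>\<^esub>"
      by blast
  qed (auto simp: free_module_add_closed, auto simp: free_module_carrier a_ac)
qed (auto simp: free_module_smult_closed,
    auto simp: free_module_carrier l_distr r_distr m_assoc)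

lemma free_module_eval: "functional R (free_module R \<Gamma>) (\<lambda>c. c i)"
  unfolding functional_def
  using module.axioms(2)[OF free_module_module]
  by (intro conjI ballI abelian_group_homI is_abelian_group) (auto simp: free_module_carrier)

lemma free_module_sum:
  assumes "f \<in> F \<rightarrow> carrier (free_module R \<Gamma>)"
  shows "(\<Oplus>\<^bsub>free_module R \<Gamma>\<^esub>h\<in>F. f h) i = (\<Oplus>h\<in>F. f h i)"
  using abelian_group_hom.hom_finsum[OF functional_hom[OF free_module_eval] assms] .

end

definition lincomb ::
  "('r, 'c) ring_scheme \<Rightarrow> ('r, 'm, 'e) module_scheme \<Rightarrow> ('i \<Rightarrow> 'm) \<Rightarrow> ('i \<Rightarrow> 'r) \<Rightarrow> 'm" where
  "lincomb R M p c = (\<Oplus>\<^bsub>M\<^esub>i\<in>{i. c i \<noteq> \<zero>\<^bsub>R\<^esub>}. c i \<odot>\<^bsub>M\<^esub> p i)"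

context module
begin

context
  fixes \<Gamma> :: "'i set" and p :: "'i \<Rightarrow> 'c"
  assumes p: "p \<in> \<Gamma> \<rightarrow> carrier M"
begin

lemma lincomb_term:
  assumes "c \<in> carrier (free_module R \<Gamma>)" "i \<in> \<Gamma>"
  shows "c i \<odot>\<^bsub>M\<^esub> p i \<in> carrier M"
  using assms p by (intro smult_closed) (auto simp: free_module_carrier)

lemma lincomb_superset:
  assumes c: "c \<in> carrier (free_module R \<Gamma>)" and F: "finite F" "{i. c i \<noteq> \<zero>} \<subseteq> F" "F \<subseteq> \<Gamma>"
  shows "lincomb R M p c = (\<Oplus>\<^bsub>M\<^esub>i\<in>F. c i \<odot>\<^bsub>M\<^esub> p i)"
  unfolding lincomb_def
proof (rule M.add.finprod_mono_neutral_cong_left[OF F(1,2)])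
  show "(\<lambda>i. c i \<odot>\<^bsub>M\<^esub> p i) \<in> F \<rightarrow> carrier M"
    using lincomb_term[OF c] F(3) by auto
  show "c i \<odot>\<^bsub>M\<^esub> p i = \<zero>\<^bsub>M\<^esub>" if "i \<in> F - {i. c i \<noteq> \<zero>}" for i
    using that p F(3) by (auto dest: Pi_mem)
qed simp

lemma free_module_support:
  "c \<in> carrier (free_module R \<Gamma>) \<Longrightarrow> finite {i. c i \<noteq> \<zero>} \<and> {i. c i \<noteq> \<zero>} \<subseteq> \<Gamma>"
  by (auto simp: free_module_carrier)

lemma lincomb_closed:
  assumes "c \<in> carrier (free_module R \<Gamma>)"
  shows "lincomb R M p c \<in> carrier M"
  unfolding lincomb_def using lincomb_term[OF assms] free_module_support[OF assms]
  by (intro M.finsum_closed) auto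

lemma lincomb_add:
  assumes c: "c \<in> carrier (free_module R \<Gamma>)" and c': "c' \<in> carrier (free_module R \<Gamma>)"
  shows "lincomb R M p (\<lambda>i. c i \<oplus> c' i) = lincomb R M p c \<oplus>\<^bsub>M\<^esub> lincomb R M p c'"
proof -
  let ?F = "{i. c i \<noteq> \<zero>} \<union> {i. c' i \<noteq> \<zero>}"
  have F: "finite ?F" "?F \<subseteq> \<Gamma>"
    using free_module_support[OF c] free_module_support[OF c'] by auto
  have cl: "c i \<in> carrier R" "c' i \<in> carrier R" for i
    using c c' by (auto simp: free_module_carrier)
  have "lincomb R M p (\<lambda>i. c i \<oplus> c' i) = (\<Oplus>\<^bsub>M\<^esub>i\<in>?F. (c i \<oplus> c' i) \<odot>\<^bsub>M\<^esub> p i)"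
    using R.free_module_add_closed[OF c c'] F by (intro lincomb_superset) auto
  also have "\<dots> = (\<Oplus>\<^bsub>M\<^esub>i\<in>?F. c i \<odot>\<^bsub>M\<^esub> p i \<oplus>\<^bsub>M\<^esub> c' i \<odot>\<^bsub>M\<^esub> p i)"
    using lincomb_term[OF c] lincomb_term[OF c'] subsetD[OF F(2)] Pi_mem[OF p] cl
    by (intro M.finsum_cong' Pi_I M.add.m_closed smult_l_distr) (auto simp del: mem_Collect_eq Un_iff)
  also have "\<dots> = (\<Oplus>\<^bsub>M\<^esub>i\<in>?F. c i \<odot>\<^bsub>M\<^esub> p i) \<oplus>\<^bsub>M\<^esub> (\<Oplus>\<^bsub>M\<^esub>i\<in>?F. c' i \<odot>\<^bsub>M\<^esub> p i)"
    using lincomb_term[OF c] lincomb_term[OF c'] subsetD[OF F(2)]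
    by (intro M.finsum_addf Pi_I) auto
  also have "\<dots> = lincomb R M p c \<oplus>\<^bsub>M\<^esub> lincomb R M p c'"
    using lincomb_superset[OF c F(1) _ F(2)] lincomb_superset[OF c' F(1) _ F(2)] by simp
  finally show ?thesis .
qed

lemma lincomb_smult:
  assumes a: "a \<in> carrier R" and c: "c \<in> carrier (free_module R \<Gamma>)"
  shows "lincomb R M p (\<lambda>i. a \<otimes> c i) = a \<odot>\<^bsub>M\<^esub> lincomb R M p c"
proof -
  let ?F = "{i. c i \<noteq> \<zero>}"
  have F: "finite ?F" "?F \<subseteq> \<Gamma>"
    using free_module_support[OF c] by auto
  have cl: "c i \<in> carrier R" for i
    using c by (auto simp: free_module_carrier)
  have "lincomb R M p (\<lambda>i. a \<otimes> c i) = (\<Oplus>\<^bsub>M\<^esub>i\<in>?F. (a \<otimes> c i) \<odot>\<^bsub>M\<^esub> p i)"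
    using R.free_module_smult_closed[OF a c] F a by (intro lincomb_superset) auto
  also have "\<dots> = (\<Oplus>\<^bsub>M\<^esub>i\<in>?F. a \<odot>\<^bsub>M\<^esub> (c i \<odot>\<^bsub>M\<^esub> p i))"
    using lincomb_term[OF c] subsetD[OF F(2)] Pi_mem[OF p] cl a
    by (intro M.finsum_cong' Pi_I smult_closed smult_assoc1) auto
  also have "\<dots> = a \<odot>\<^bsub>M\<^esub> lincomb R M p c"
    unfolding lincomb_def using lincomb_term[OF c] subsetD[OF F(2)]
    by (intro finsum_smult_ldistr[symmetric] F(1) a Pi_I) auto
  finally show ?thesis .
qed

lemma lincomb_hom: "abelian_group_hom (free_module R \<Gamma>) M (lincomb R M p)"
  using module.axioms(2)[OF R.free_module_module]
  by (intro abelian_group_homI M.abelian_group_axioms) (auto simp: lincomb_closed lincomb_add)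

lemma lincomb_single:
  assumes i: "i \<in> \<Gamma>" and a: "a \<in> carrier R"
  shows "(\<lambda>j. if j = i then a else \<zero>) \<in> carrier (free_module R \<Gamma>)"
    and "lincomb R M p (\<lambda>j. if j = i then a else \<zero>) = a \<odot>\<^bsub>M\<^esub> p i"
proof -
  show c: "(\<lambda>j. if j = i then a else \<zero>) \<in> carrier (free_module R \<Gamma>)"
    using assms by (auto simp: free_module_carrier)
  have "lincomb R M p (\<lambda>j. if j = i then a else \<zero>) = (\<Oplus>\<^bsub>M\<^esub>j\<in>{i}. (if j = i then a else \<zero>) \<odot>\<^bsub>M\<^esub> p j)"
    using i by (intro lincomb_superset c) auto
  also have "\<dots> = a \<odot>\<^bsub>M\<^esub> p i"
    using i a Pi_mem[OF p] by simp
  finally show "lincomb R M p (\<lambda>j. if j = i then a else \<zero>) = a \<odot>\<^bsub>M\<^esub> p i" .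
qed

end

end

context graded_mod
begin

section \<open>The grading of a free module\<close>

text \<open>
  The basis element at \<open>i\<close> gets degree \<open>deg i\<close>, so a family is homogeneous of degree \<open>h\<close> when its
  coefficient at \<open>i\<close> has degree \<open>h - deg i\<close>, in additive notation.
\<close>
definition free_grading :: "'i set \<Rightarrow> ('i \<Rightarrow> 'g) \<Rightarrow> 'g \<Rightarrow> ('i \<Rightarrow> 'r) set" where
  "free_grading \<Gamma> deg h =
     {c \<in> carrier (free_module R \<Gamma>). \<forall>i\<in>\<Gamma>. c i \<in> \<R> (h \<otimes>\<^bsub>G\<^esub> inv\<^bsub>G\<^esub> deg i)}"

context
  fixes \<Gamma> :: "'i set" and deg :: "'i \<Rightarrow> 'g"
  assumes deg: "deg \<in> \<Gamma> \<rightarrow> carrier G"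
begin

lemma shift_closed: "i \<in> \<Gamma> \<Longrightarrow> h \<in> carrier G \<Longrightarrow> h \<otimes>\<^bsub>G\<^esub> inv\<^bsub>G\<^esub> deg i \<in> carrier G"
  using deg by (auto dest: Pi_mem)

lemma shift_inverse:
  "i \<in> \<Gamma> \<Longrightarrow> h \<in> carrier G \<Longrightarrow> (h \<otimes>\<^bsub>G\<^esub> inv\<^bsub>G\<^esub> deg i) \<otimes>\<^bsub>G\<^esub> deg i = h"
  "i \<in> \<Gamma> \<Longrightarrow> h \<in> carrier G \<Longrightarrow> (h \<otimes>\<^bsub>G\<^esub> deg i) \<otimes>\<^bsub>G\<^esub> inv\<^bsub>G\<^esub> deg i = h"
  using Pi_mem[OF deg] by (simp_all add: G.m_assoc)

lemma shift_inj: "i \<in> \<Gamma> \<Longrightarrow> F \<subseteq> carrier G \<Longrightarrow> inj_on (\<lambda>h. h \<otimes>\<^bsub>G\<^esub> inv\<^bsub>G\<^esub> deg i) F"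
  by (rule inj_on_inverseI[of _ "\<lambda>h. h \<otimes>\<^bsub>G\<^esub> deg i"]) (auto simp: shift_inverse)

lemma free_grading_subgroup:
  assumes h: "h \<in> carrier G"
  shows "additive_subgroup (free_grading \<Gamma> deg h) (free_module R \<Gamma>)"
proof (rule additive_subgroupI)
  interpret N: module R "free_module R \<Gamma>"
    by (rule R.free_module_module)
  have minus: "(\<ominus>\<^bsub>free_module R \<Gamma>\<^esub> c) i = \<ominus>\<^bsub>R\<^esub> c i" if "c \<in> carrier (free_module R \<Gamma>)" for c i
    using N.functional_minus[OF R.free_module_eval that] .
  show "subgroup (free_grading \<Gamma> deg h) (add_monoid (free_module R \<Gamma>))"
  proof (rule N.add.subgroupI)
    show "free_grading \<Gamma> deg h \<subseteq> carrier (free_module R \<Gamma>)"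
      by (auto simp: free_grading_def)
    have "\<zero>\<^bsub>free_module R \<Gamma>\<^esub> \<in> free_grading \<Gamma> deg h"
      using RD.summand_zero[OF shift_closed] h
      by (auto simp: free_grading_def free_module_carrier)
    then show "free_grading \<Gamma> deg h \<noteq> {}" by auto
    show "\<ominus>\<^bsub>free_module R \<Gamma>\<^esub> c \<in> free_grading \<Gamma> deg h" if "c \<in> free_grading \<Gamma> deg h" for c
      using that RD.summand_minus[OF shift_closed[OF _ h]] by (simp add: free_grading_def minus)
    show "c \<oplus>\<^bsub>free_module R \<Gamma>\<^esub> c' \<in> free_grading \<Gamma> deg h"
      if "c \<in> free_grading \<Gamma> deg h" "c' \<in> free_grading \<Gamma> deg h" for c c'
      using that RD.summand_add[OF shift_closed[OF _ h]]
      by (simp add: free_grading_def R.free_module_add_closed)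
  qed
qed

text \<open>
  The part of degree \<open>h\<close> takes at each \<open>i\<close> the component of \<open>c i\<close> of degree \<open>h - deg i\<close>. Only finitely
  many \<open>h\<close> give a nonzero part, because \<open>c\<close> has finite support and each \<open>c i\<close> finitely many components.
\<close>
lemma free_grading_decompose:
  assumes c: "c \<in> carrier (free_module R \<Gamma>)"
  shows "c \<in> family_sum (free_module R \<Gamma>) (carrier G) (free_grading \<Gamma> deg)"
proof -
  have cl: "c i \<in> carrier R" for i
    using c by (simp add: free_module_carrier)
  define part where "part h i = (if i \<in> \<Gamma> then RD.component (c i) (h \<otimes>\<^bsub>G\<^esub> inv\<^bsub>G\<^esub> deg i) else \<zero>\<^bsub>R\<^esub>)" for h i
  define H where "H = (\<Union>i\<in>{i. c i \<noteq> \<zero>\<^bsub>R\<^esub>}. (\<lambda>l. l \<otimes>\<^bsub>G\<^esub> deg i) ` {l. RD.component (c i) l \<noteq> \<zero>\<^bsub>R\<^esub>})"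
  have supp: "finite {i. c i \<noteq> \<zero>\<^bsub>R\<^esub>}" "{i. c i \<noteq> \<zero>\<^bsub>R\<^esub>} \<subseteq> \<Gamma>"
    using c by (auto simp: free_module_carrier)
  have H: "finite H" "H \<subseteq> carrier G"
    using supp(1) RD.finite_component[OF cl] subsetD[OF RD.component_support[OF cl]] subsetD[OF supp(2)]
      Pi_mem[OF deg] by (auto simp: H_def)
  have part_carrier: "part h \<in> carrier (free_module R \<Gamma>)" for h
  proof -
    have "{i. part h i \<noteq> \<zero>\<^bsub>R\<^esub>} \<subseteq> {i. c i \<noteq> \<zero>\<^bsub>R\<^esub>}"
      by (auto simp: part_def component_zero)
    then have "finite {i. part h i \<noteq> \<zero>\<^bsub>R\<^esub>}"
      using supp(1) finite_subset by blast
    then show ?thesis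
      using RD.component_closed[OF cl] by (simp add: free_module_carrier part_def)
  qed
  have "part h \<in> free_grading \<Gamma> deg h" if "h \<in> carrier G" for h
    using part_carrier RD.component_mem[OF cl shift_closed[OF _ that]] by (simp add: free_grading_def part_def)
  then have part_mem: "part \<in> (\<Pi> h\<in>H. free_grading \<Gamma> deg h)"
    using subsetD[OF H(2)] by simp
  have "c = (\<Oplus>\<^bsub>free_module R \<Gamma>\<^esub>h\<in>H. part h)"
  proof (rule ext)
    fix i
    have "c i = (\<Oplus>\<^bsub>R\<^esub>h\<in>H. part h i)"
    proof (cases "i \<in> \<Gamma>")
      case False
      then show ?thesis
        using c by (simp add: part_def free_module_carrier)
    next
      case True
      let ?s = "\<lambda>h. h \<otimes>\<^bsub>G\<^esub> inv\<^bsub>G\<^esub> deg i"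
      have "{l. RD.component (c i) l \<noteq> \<zero>\<^bsub>R\<^esub>} \<subseteq> ?s ` H"
      proof (rule subsetI)
        fix l assume l: "l \<in> {l. RD.component (c i) l \<noteq> \<zero>\<^bsub>R\<^esub>}"
        then have "l \<in> carrier G" "c i \<noteq> \<zero>\<^bsub>R\<^esub>"
          using RD.component_support[OF cl, of i] by (auto simp: component_zero)
        then have "l = ?s (l \<otimes>\<^bsub>G\<^esub> deg i)" "l \<otimes>\<^bsub>G\<^esub> deg i \<in> H"
          using True l by (auto simp: shift_inverse H_def)
        then show "l \<in> ?s ` H" by (rule image_eqI)
      qed
      then have "c i = (\<Oplus>\<^bsub>R\<^esub>l\<in>?s ` H. RD.component (c i) l)"
        using RD.sum_component[OF cl] H(1) by simp
      also have "\<dots> = (\<Oplus>\<^bsub>R\<^esub>h\<in>H. RD.component (c i) (?s h))"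
        using RD.component_closed[OF cl] shift_inj[OF True H(2)] by (intro R.finsum_reindex) auto
      finally show ?thesis
        using True by (simp add: part_def)
    qed
    also have "\<dots> = (\<Oplus>\<^bsub>free_module R \<Gamma>\<^esub>h\<in>H. part h) i"
      using part_carrier by (intro R.free_module_sum[symmetric]) auto
    finally show "c i = (\<Oplus>\<^bsub>free_module R \<Gamma>\<^esub>h\<in>H. part h) i" .
  qed
  then show ?thesis
    unfolding family_sum_def mem_Collect_eq using H part_mem by (intro exI conjI)
qed

text \<open>
  At each index the relation becomes one in \<open>R\<close> between elements of different degrees, since the
  translation by \<open>deg i\<close> is injective.
\<close>
lemma free_grading_independent:
  assumes F: "finite F" "F \<subseteq> carrier G" and f: "f \<in> (\<Pi> h\<in>F. free_grading \<Gamma> deg h)"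
    and sum: "(\<Oplus>\<^bsub>free_module R \<Gamma>\<^esub>h\<in>F. f h) = \<zero>\<^bsub>free_module R \<Gamma>\<^esub>" and h0: "h0 \<in> F"
  shows "f h0 = \<zero>\<^bsub>free_module R \<Gamma>\<^esub>"
proof -
  have fc: "f \<in> F \<rightarrow> carrier (free_module R \<Gamma>)"
    using f by (auto simp: free_grading_def)
  have "f h0 i = \<zero>\<^bsub>R\<^esub>" for i
  proof (cases "i \<in> \<Gamma>")
    case False
    then show ?thesis
      using Pi_mem[OF fc h0] by (simp add: free_module_carrier)
  next
    case True
    let ?s = "\<lambda>h. h \<otimes>\<^bsub>G\<^esub> inv\<^bsub>G\<^esub> deg i"
    let ?f = "\<lambda>l. f (l \<otimes>\<^bsub>G\<^esub> deg i) i"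
    have s: "?s h \<otimes>\<^bsub>G\<^esub> deg i = h" if "h \<in> F" for h
      using that F(2) True by (auto simp: shift_inverse)
    have mem: "?f l \<in> \<R> l" if l: "l \<in> ?s ` F" for l
    proof -
      from l obtain h where h: "h \<in> F" "l = ?s h" by auto
      then have "f h i \<in> \<R> (?s h)"
        using Pi_mem[OF f h(1)] True by (simp add: free_grading_def)
      then show ?thesis
        using s[OF h(1)] h(2) by simp
    qed
    have sF: "finite (?s ` F)" "?s ` F \<subseteq> carrier G"
      using F shift_closed[OF True] by auto
    have "(\<Oplus>\<^bsub>R\<^esub>l\<in>?s ` F. ?f l) = (\<Oplus>\<^bsub>R\<^esub>h\<in>F. ?f (?s h))"
    proof (rule R.finsum_reindex[OF _ shift_inj[OF True F(2)]])
      show "?f \<in> ?s ` F \<rightarrow> carrier R"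
        using RD.summand_closed[OF subsetD[OF sF(2)] mem] by (intro Pi_I)
    qed
    also have "\<dots> = (\<Oplus>\<^bsub>R\<^esub>h\<in>F. f h i)"
      using s fc by (intro R.finsum_cong') (auto simp: free_module_carrier dest: Pi_mem)
    also have "\<dots> = \<zero>\<^bsub>R\<^esub>"
      using R.free_module_sum[OF fc, of i] sum by simp
    finally have "(\<Oplus>\<^bsub>R\<^esub>l\<in>?s ` F. ?f l) = (\<Oplus>\<^bsub>R\<^esub>l\<in>?s ` F. \<zero>\<^bsub>R\<^esub>)"
      by simp
    moreover have "?f \<in> (\<Pi> l\<in>?s ` F. \<R> l)" "(\<lambda>l. \<zero>\<^bsub>R\<^esub>) \<in> (\<Pi> l\<in>?s ` F. \<R> l)"
      using mem RD.summand_zero[OF subsetD[OF sF(2)]] by (blast intro: Pi_I)+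
    ultimately have "?f (?s h0) = \<zero>\<^bsub>R\<^esub>"
      using RD.unique_decomposition[OF sF, of ?f "\<lambda>l. \<zero>\<^bsub>R\<^esub>" "?s h0"] h0 by simp
    then show ?thesis
      using s[OF h0] by simp
  qed
  then show ?thesis by auto
qed

lemma free_module_graded: "graded_module G R \<R> (free_module R \<Gamma>) (free_grading \<Gamma> deg)"
  unfolding graded_module_def internal_direct_sum_def
proof (intro conjI ballI allI impI)
  show "graded_ring G R \<R>" by (rule graded_ring)
  show N: "module R (free_module R \<Gamma>)" by (rule R.free_module_module)
  interpret N: module R "free_module R \<Gamma>" by (rule N)
  show "additive_subgroup (free_grading \<Gamma> deg h) (free_module R \<Gamma>)" if "h \<in> carrier G" for h
    using free_grading_subgroup[OF that] .
  show "carrier (free_module R \<Gamma>) = family_sum (free_module R \<Gamma>) (carrier G) (free_grading \<Gamma> deg)"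
  proof (intro equalityI subsetI free_grading_decompose)
    fix c assume "c \<in> family_sum (free_module R \<Gamma>) (carrier G) (free_grading \<Gamma> deg)"
    then obtain F f where "f \<in> (\<Pi> h\<in>F. free_grading \<Gamma> deg h)" "c = (\<Oplus>\<^bsub>free_module R \<Gamma>\<^esub>h\<in>F. f h)"
      unfolding family_sum_def mem_Collect_eq by (elim exE conjE)
    moreover from this(1) have "f \<in> F \<rightarrow> carrier (free_module R \<Gamma>)"
      by (auto simp: free_grading_def)
    ultimately show "c \<in> carrier (free_module R \<Gamma>)"
      using N.M.finsum_closed by simp
  qed
  show "f h = \<zero>\<^bsub>free_module R \<Gamma>\<^esub>"
    if "finite F" "F \<subseteq> carrier G" "f \<in> (\<Pi> h\<in>F. free_grading \<Gamma> deg h)"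
      "(\<Oplus>\<^bsub>free_module R \<Gamma>\<^esub>h\<in>F. f h) = \<zero>\<^bsub>free_module R \<Gamma>\<^esub>" "h \<in> F" for F f h
    using that by (rule free_grading_independent)
  show "a \<odot>\<^bsub>free_module R \<Gamma>\<^esub> c \<in> free_grading \<Gamma> deg (g \<otimes>\<^bsub>G\<^esub> h)"
    if g: "g \<in> carrier G" "h \<in> carrier G" "a \<in> \<R> g" "c \<in> free_grading \<Gamma> deg h" for g h a c
  proof -
    have "a \<in> carrier R"
      using RD.summand_closed[OF g(1,3)] .
    moreover have "a \<otimes>\<^bsub>R\<^esub> c i \<in> \<R> ((g \<otimes>\<^bsub>G\<^esub> h) \<otimes>\<^bsub>G\<^esub> inv\<^bsub>G\<^esub> deg i)" if i: "i \<in> \<Gamma>" for i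
      using ring_mult_mem[OF g(1) shift_closed[OF i g(2)] g(3), of "c i"] g(1,2,4) i Pi_mem[OF deg i]
      by (simp add: free_grading_def G.m_assoc)
    ultimately show ?thesis
      using g(4) by (simp add: free_grading_def R.free_module_smult_closed)
  qed
qed

end

end

section \<open>Copying a graded module along an injection\<close>

text \<open>
  Projectivity is tested against modules in one fixed type only, so \<open>M\<close> has to be replaced by a copy
  in that type before the canonical epimorphism onto it can be lifted.
\<close>
definition transport :: "('m \<Rightarrow> 'u) \<Rightarrow> ('r, 'm, 'e) module_scheme \<Rightarrow> ('r, 'u) module" where
  "transport \<iota> M =
     \<lparr>carrier = \<iota> ` carrier M, mult = undefined, one = undefined, zero = \<iota> \<zero>\<^bsub>M\<^esub>,
      add = (\<lambda>u v. \<iota> (inv_into (carrier M) \<iota> u \<oplus>\<^bsub>M\<^esub> inv_into (carrier M) \<iota> v)),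
      smult = (\<lambda>a u. \<iota> (a \<odot>\<^bsub>M\<^esub> inv_into (carrier M) \<iota> u))\<rparr>"

context module
begin

context
  fixes \<iota> :: "'c \<Rightarrow> 'u"
  assumes \<iota>: "inj_on \<iota> (carrier M)"
begin

lemma transport_simps:
  "carrier (transport \<iota> M) = \<iota> ` carrier M"
  "\<zero>\<^bsub>transport \<iota> M\<^esub> = \<iota> \<zero>\<^bsub>M\<^esub>"
  "x \<in> carrier M \<Longrightarrow> y \<in> carrier M \<Longrightarrow> \<iota> x \<oplus>\<^bsub>transport \<iota> M\<^esub> \<iota> y = \<iota> (x \<oplus>\<^bsub>M\<^esub> y)"
  "x \<in> carrier M \<Longrightarrow> a \<odot>\<^bsub>transport \<iota> M\<^esub> \<iota> x = \<iota> (a \<odot>\<^bsub>M\<^esub> x)"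
  using \<iota> by (simp_all add: transport_def)

lemma transport_module: "module R (transport \<iota> M)"
proof (rule moduleI)
  show "cring R" by (rule R.is_cring)
  show "abelian_group (transport \<iota> M)"
  proof (rule abelian_groupI)
    fix u assume "u \<in> carrier (transport \<iota> M)"
    then obtain x where "x \<in> carrier M" "u = \<iota> x"
      by (auto simp: transport_simps)
    then show "\<exists>v\<in>carrier (transport \<iota> M). v \<oplus>\<^bsub>transport \<iota> M\<^esub> u = \<zero>\<^bsub>transport \<iota> M\<^esub>"
      by (intro bexI[of _ "\<iota> (\<ominus>\<^bsub>M\<^esub> x)"]) (auto simp: transport_simps M.l_neg)
  qed (auto simp: transport_simps M.a_ac)
qed (auto simp: transport_simps smult_l_distr smult_r_distr smult_assoc1)

lemma transport_hom: "abelian_group_hom M (transport \<iota> M) \<iota>"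
  using module.axioms(2)[OF transport_module]
  by (intro abelian_group_homI M.abelian_group_axioms) (auto simp: transport_simps)

end

end

lemma (in graded_mod) transport_graded:
  assumes \<iota>: "inj_on \<iota> (carrier M)"
  shows "graded_module G R \<R> (transport \<iota> M) (\<lambda>g. \<iota> ` \<M> g)"
  unfolding graded_module_def internal_direct_sum_def
proof (intro conjI ballI allI impI)
  show "graded_ring G R \<R>" by (rule graded_ring)
  show "module R (transport \<iota> M)" by (rule transport_module[OF \<iota>])
  interpret h: abelian_group_hom M "transport \<iota> M" \<iota>
    by (rule transport_hom[OF \<iota>])
  interpret hom: group_hom "add_monoid M" "add_monoid (transport \<iota> M)" \<iota>
    by (rule h.a_group_hom)
  have lift: "\<exists>f'. f' \<in> (\<Pi> g\<in>F. \<M> g) \<and> f' \<in> F \<rightarrow> carrier M \<and> (\<forall>g\<in>F. f g = \<iota> (f' g)) \<and>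
      (\<Oplus>\<^bsub>transport \<iota> M\<^esub>g\<in>F. f g) = \<iota> (\<Oplus>\<^bsub>M\<^esub>g\<in>F. f' g)"
    if F: "F \<subseteq> carrier G" and f: "f \<in> (\<Pi> g\<in>F. \<iota> ` \<M> g)" for F f
  proof -
    have "\<forall>g\<in>F. \<exists>x. x \<in> \<M> g \<and> f g = \<iota> x"
      using f by auto
    then obtain f' where f': "\<forall>g\<in>F. f' g \<in> \<M> g \<and> f g = \<iota> (f' g)"
      by (rule bchoice[THEN exE])
    then have fc: "f' \<in> F \<rightarrow> carrier M"
      using MD.summand_closed[OF subsetD[OF F]] by (intro Pi_I) simp
    have "(\<Oplus>\<^bsub>transport \<iota> M\<^esub>g\<in>F. f g) = (\<Oplus>\<^bsub>transport \<iota> M\<^esub>g\<in>F. \<iota> (f' g))"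
      using f' fc by (intro h.H.finsum_cong') (auto simp: transport_simps(1)[OF \<iota>])
    then show ?thesis
      using f' fc h.hom_finsum[OF fc] by (intro exI[of _ f']) auto
  qed
  show "additive_subgroup (\<iota> ` \<M> g) (transport \<iota> M)" if "g \<in> carrier G" for g
    using hom.subgroup_img_is_subgroup[OF additive_subgroup.a_subgroup[OF MD.summand_subgroup[OF that]]]
    by (rule additive_subgroupI)
  show "carrier (transport \<iota> M) = family_sum (transport \<iota> M) (carrier G) (\<lambda>g. \<iota> ` \<M> g)"
  proof (intro equalityI subsetI)
    fix u assume "u \<in> carrier (transport \<iota> M)"
    then obtain x where x: "x \<in> carrier M" "u = \<iota> x"
      by (auto simp: transport_simps(1)[OF \<iota>])
    obtain F f where F: "finite F" "F \<subseteq> carrier G" "f \<in> (\<Pi> g\<in>F. \<M> g)" "f \<in> F \<rightarrow> carrier M"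
        "x = (\<Oplus>\<^bsub>M\<^esub>g\<in>F. f g)"
      using MD.decompose[OF x(1)] .
    have "u = (\<Oplus>\<^bsub>transport \<iota> M\<^esub>g\<in>F. \<iota> (f g))"
      unfolding x(2) F(5) by (rule h.hom_finsum[OF F(4)])
    moreover have "(\<lambda>g. \<iota> (f g)) \<in> (\<Pi> g\<in>F. \<iota> ` \<M> g)"
      using F(3) by auto
    ultimately show "u \<in> family_sum (transport \<iota> M) (carrier G) (\<lambda>g. \<iota> ` \<M> g)"
      unfolding family_sum_def mem_Collect_eq using F(1,2) by (intro exI conjI)
  next
    fix u assume "u \<in> family_sum (transport \<iota> M) (carrier G) (\<lambda>g. \<iota> ` \<M> g)"
    then obtain F f where F: "F \<subseteq> carrier G" "f \<in> (\<Pi> g\<in>F. \<iota> ` \<M> g)"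
        "u = (\<Oplus>\<^bsub>transport \<iota> M\<^esub>g\<in>F. f g)"
      unfolding family_sum_def mem_Collect_eq by (elim exE conjE)
    then show "u \<in> carrier (transport \<iota> M)"
      using lift[OF F(1,2)] M.finsum_closed by (auto simp: transport_simps(1)[OF \<iota>])
  qed
  show "f g = \<zero>\<^bsub>transport \<iota> M\<^esub>"
    if F: "finite F" "F \<subseteq> carrier G" "f \<in> (\<Pi> g\<in>F. \<iota> ` \<M> g)"
      "(\<Oplus>\<^bsub>transport \<iota> M\<^esub>g\<in>F. f g) = \<zero>\<^bsub>transport \<iota> M\<^esub>" "g \<in> F" for F f g
  proof -
    obtain f' where f': "f' \<in> (\<Pi> g\<in>F. \<M> g)" "f' \<in> F \<rightarrow> carrier M" "\<forall>g\<in>F. f g = \<iota> (f' g)"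
        "(\<Oplus>\<^bsub>transport \<iota> M\<^esub>g\<in>F. f g) = \<iota> (\<Oplus>\<^bsub>M\<^esub>g\<in>F. f' g)"
      using lift[OF F(2,3)] by (elim exE conjE)
    have "(\<Oplus>\<^bsub>M\<^esub>g\<in>F. f' g) = \<zero>\<^bsub>M\<^esub>"
    proof (rule inj_onD[OF \<iota> _ M.finsum_closed[OF f'(2)] M.zero_closed])
      show "\<iota> (\<Oplus>\<^bsub>M\<^esub>g\<in>F. f' g) = \<iota> \<zero>\<^bsub>M\<^esub>"
        using F(4) unfolding f'(4) transport_simps(2)[OF \<iota>] .
    qed
    then have "f' g = \<zero>\<^bsub>M\<^esub>"
      by (rule MD.independent[OF F(1,2) f'(1) _ F(5)])
    then show ?thesis
      using bspec[OF f'(3) F(5)] by simp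
  qed
  show "a \<odot>\<^bsub>transport \<iota> M\<^esub> u \<in> \<iota> ` \<M> (g \<otimes>\<^bsub>G\<^esub> h)"
    if g: "g \<in> carrier G" "h \<in> carrier G" "a \<in> \<R> g" "u \<in> \<iota> ` \<M> h" for g h a u
  proof -
    obtain x where x: "x \<in> \<M> h" "u = \<iota> x" using g(4) by auto
    then have "a \<odot>\<^bsub>transport \<iota> M\<^esub> u = \<iota> (a \<odot>\<^bsub>M\<^esub> x)"
      using MD.summand_closed[OF g(2)] by (simp add: transport_simps(4)[OF \<iota>])
    then show ?thesis
      using smult_mem[OF g(1,2,3) x(1)] by simp
  qed
qed

context graded_mod
begin

section \<open>Projective modules and coarsenings\<close>

lemma lincomb_graded:
  assumes deg: "deg \<in> \<Gamma> \<rightarrow> carrier G" and p: "\<And>i. i \<in> \<Gamma> \<Longrightarrow> p i \<in> \<M> (deg i)"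
    and h: "h \<in> carrier G" and c: "c \<in> free_grading \<Gamma> deg h"
  shows "lincomb R M p c \<in> \<M> h"
  unfolding lincomb_def
proof (rule MD.finsum_mem_subgroup[OF MD.summand_subgroup[OF h]], rule Pi_I)
  fix i assume "i \<in> {i. c i \<noteq> \<zero>\<^bsub>R\<^esub>}"
  then have i: "i \<in> \<Gamma>"
    using c by (auto simp: free_grading_def free_module_carrier)
  then have "c i \<in> \<R> (h \<otimes>\<^bsub>G\<^esub> inv\<^bsub>G\<^esub> deg i)"
    using c by (simp add: free_grading_def)
  then have "c i \<odot>\<^bsub>M\<^esub> p i \<in> \<M> ((h \<otimes>\<^bsub>G\<^esub> inv\<^bsub>G\<^esub> deg i) \<otimes>\<^bsub>G\<^esub> deg i)"
    using Pi_mem[OF deg i] by (intro smult_mem shift_closed[OF deg i h] p[OF i])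
  then show "c i \<odot>\<^bsub>M\<^esub> p i \<in> \<M> h"
    using shift_inverse(1)[OF deg i h] by simp
qed

text \<open>
  The identity of \<open>M\<close>, viewed as a map onto the copy \<open>?P\<close>, lifts along the canonical epimorphism from
  the free graded module on the homogeneous elements. The lift is injective, and its coordinates are
  the required functionals.
\<close>
theorem projective_imp_free:
  assumes principal: "graded_principal G R \<R>"
    and projective: "graded_projective TYPE('g \<times> 'm \<Rightarrow> 'r) G R \<R> M \<M>"
  shows "graded_free G R M \<M>"
proof -
  define \<Gamma> where "\<Gamma> = (SIGMA g:carrier G. \<M> g)"
  let ?N = "free_module R \<Gamma>" and ?\<N> = "free_grading \<Gamma> fst"
  \<comment> \<open>Indicator functions distinguish the elements of \<open>M\<close> because \<open>R\<close> is not the zero ring.\<close>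
  define \<iota> :: "'m \<Rightarrow> 'g \<times> 'm \<Rightarrow> 'r" where "\<iota> x = (\<lambda>(g, y). if y = x then \<one>\<^bsub>R\<^esub> else \<zero>\<^bsub>R\<^esub>)" for x
  let ?P = "transport \<iota> M" and ?\<P> = "\<lambda>g. \<iota> ` \<M> g"
  let ?L = "lincomb R M snd"
  have deg: "fst \<in> \<Gamma> \<rightarrow> carrier G" and p: "snd \<in> \<Gamma> \<rightarrow> carrier M"
    using MD.summand_closed by (auto simp: \<Gamma>_def)
  have "carrier R \<noteq> {\<zero>\<^bsub>R\<^esub>}"
    using principal by (simp add: graded_principal_def graded_entire_def)
  then have one: "\<one>\<^bsub>R\<^esub> \<noteq> \<zero>\<^bsub>R\<^esub>"
    using R.one_zeroD by blast
  have "inj \<iota>"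
  proof (rule injI)
    fix x y assume "\<iota> x = \<iota> y"
    then have "\<iota> x (undefined, x) = \<iota> y (undefined, x)" by simp
    then show "x = y"
      using one by (simp add: \<iota>_def split: if_splits)
  qed
  then have \<iota>: "inj_on \<iota> (carrier M)"
    by (rule inj_on_subset) simp
  note \<iota>_simps = transport_simps[OF \<iota>]
  interpret L: abelian_group_hom ?N M ?L
    by (rule lincomb_hom[OF p])
  have L_surj: "\<exists>c\<in>carrier ?N. ?L c = x" if "x \<in> carrier M" for x
    using that
  proof (induction x rule: MD.homogeneous_induct)
    case zero
    show ?case
      using L.hom_zero by (intro bexI[of _ "\<zero>\<^bsub>?N\<^esub>"]) (simp, rule L.G.zero_closed)
  next
    case (homog g x)
    then have "(g, x) \<in> \<Gamma>"
      by (simp add: \<Gamma>_def)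
    from lincomb_single[OF p this R.one_closed] show ?case
      using MD.summand_closed[OF homog] by (metis smult_one snd_conv)
  next
    case (add x y)
    then obtain c c' where "c \<in> carrier ?N" "?L c = x" "c' \<in> carrier ?N" "?L c' = y"
      by blast
    then show ?case
      using L.hom_add by (intro bexI[of _ "c \<oplus>\<^bsub>?N\<^esub> c'"] L.G.add.m_closed) simp_all
  qed
  have N: "graded_module G R \<R> ?N ?\<N>"
    by (rule free_module_graded[OF deg])
  have P: "graded_module G R \<R> ?P ?\<P>"
    by (rule transport_graded[OF \<iota>])
  have f_hom: "\<iota> \<circ> ?L \<in> graded_hom G R ?N ?\<N> ?P ?\<P>"
    unfolding graded_hom_def mem_Collect_eq
  proof (intro conjI ballI)
    show "\<iota> \<circ> ?L \<in> carrier ?N \<rightarrow> carrier ?P"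
      by (auto simp: \<iota>_simps)
    show "(\<iota> \<circ> ?L) (c \<oplus>\<^bsub>?N\<^esub> c') = (\<iota> \<circ> ?L) c \<oplus>\<^bsub>?P\<^esub> (\<iota> \<circ> ?L) c'"
      if "c \<in> carrier ?N" "c' \<in> carrier ?N" for c c'
      using that lincomb_add[OF p that] L.hom_closed by (simp add: \<iota>_simps)
    show "(\<iota> \<circ> ?L) (a \<odot>\<^bsub>?N\<^esub> c) = a \<odot>\<^bsub>?P\<^esub> (\<iota> \<circ> ?L) c"
      if "a \<in> carrier R" "c \<in> carrier ?N" for a c
      using that lincomb_smult[OF p that] L.hom_closed by (simp add: \<iota>_simps)
    show "(\<iota> \<circ> ?L) ` ?\<N> g \<subseteq> ?\<P> g" if "g \<in> carrier G" for g
      using lincomb_graded[OF deg _ that, of snd] by (auto simp: \<Gamma>_def)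
  qed
  have f_epi: "\<iota> \<circ> ?L \<in> graded_epi G R \<R> ?N ?\<N> ?P ?\<P>"
    unfolding graded_epi_def mem_Collect_eq
  proof (intro conjI f_hom allI impI ballI)
    fix v w :: "('g \<times> 'm \<Rightarrow> 'r) \<Rightarrow> 'g \<times> 'm \<Rightarrow> 'r" and u
    assume eq: "\<forall>c\<in>carrier ?N. v ((\<iota> \<circ> ?L) c) = w ((\<iota> \<circ> ?L) c)" and "u \<in> carrier ?P"
    then obtain c where "c \<in> carrier ?N" "u = \<iota> (?L c)"
      using L_surj by (auto simp: \<iota>_simps)
    then show "v u = w u"
      using eq by simp
  qed
  have "\<iota> \<in> graded_hom G R M \<M> ?P ?\<P>"
    unfolding graded_hom_def by (auto simp: \<iota>_simps)
  then obtain v where v: "v \<in> graded_hom G R M \<M> ?N ?\<N>"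
    and split: "\<forall>x\<in>carrier M. (\<iota> \<circ> ?L) (v x) = \<iota> x"
    using projective N P f_epi unfolding graded_projective_def by meson
  have v_closed: "v x \<in> carrier ?N" if "x \<in> carrier M" for x
    using v that by (auto simp: graded_hom_def)
  show ?thesis
  proof (rule free_of_coordinates[OF principal, of \<Gamma> "\<lambda>i x. v x i"])
    show "functional R M (\<lambda>x. v x i)" for i
      unfolding functional_def
    proof (intro conjI ballI abelian_group_homI M.abelian_group_axioms R.abelian_group_axioms)
      show "(\<lambda>x. v x i) \<in> carrier M \<rightarrow> carrier R"
        using functional_closed[OF R.free_module_eval v_closed] by (rule Pi_I)
    qed (use v in \<open>simp_all add: graded_hom_def\<close>)
    show "finite {i \<in> \<Gamma>. v x i \<noteq> \<zero>\<^bsub>R\<^esub>}" if "x \<in> carrier M" for x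
      using v_closed[OF that] by (simp add: free_module_carrier)
    show "x = \<zero>\<^bsub>M\<^esub>" if x: "x \<in> carrier M" and z: "\<And>i. i \<in> \<Gamma> \<Longrightarrow> v x i = \<zero>\<^bsub>R\<^esub>" for x
    proof -
      have "v x = \<zero>\<^bsub>?N\<^esub>"
        by (rule free_module_zeroI[OF v_closed[OF x] z])
      then have "\<iota> x = \<iota> (?L \<zero>\<^bsub>?N\<^esub>)"
        using split x by (metis comp_apply)
      then show ?thesis
        using \<open>inj \<iota>\<close> L.hom_zero by (simp add: inj_eq)
    qed
  qed
qed

text \<open>
  A basis identifies \<open>M\<close> with a free module; the coordinate functionals come from the inverse. The
  elements of \<open>B\<close> may be inhomogeneous, which is what allows the passage from the coarsening back to
  the original grading.
\<close>
theorem basis_imp_free: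
  assumes principal: "graded_principal G R \<R>" and basis: "module_basis R M B"
  shows "graded_free G R M \<M>"
proof -
  let ?N = "free_module R B" and ?L = "lincomb R M (\<lambda>b. b)"
  have p: "(\<lambda>b. b) \<in> B \<rightarrow> carrier M"
    using basis by (auto simp: module_basis_def)
  interpret L: abelian_group_hom ?N M ?L
    by (rule lincomb_hom[OF p])
  have surj: "\<exists>c\<in>carrier ?N. ?L c = x" if "x \<in> carrier M" for x
  proof -
    have "\<exists>F c. finite F \<and> F \<subseteq> B \<and> c \<in> F \<rightarrow> carrier R \<and> x = (\<Oplus>\<^bsub>M\<^esub>b\<in>F. c b \<odot>\<^bsub>M\<^esub> b)"
      using basis that by (simp only: module_basis_def)
    then obtain F c where F: "finite F" "F \<subseteq> B" "c \<in> F \<rightarrow> carrier R" "x = (\<Oplus>\<^bsub>M\<^esub>b\<in>F. c b \<odot>\<^bsub>M\<^esub> b)"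
      by (elim exE conjE)
    define c' where "c' b = (if b \<in> F then c b else \<zero>\<^bsub>R\<^esub>)" for b
    have supp: "{b. c' b \<noteq> \<zero>\<^bsub>R\<^esub>} \<subseteq> F"
      by (auto simp: c'_def)
    then have "finite {b. c' b \<noteq> \<zero>\<^bsub>R\<^esub>}"
      using F(1) finite_subset by blast
    then have c': "c' \<in> carrier ?N"
      using F(2,3) by (auto simp: free_module_carrier c'_def)
    have "?L c' = (\<Oplus>\<^bsub>M\<^esub>b\<in>F. c' b \<odot>\<^bsub>M\<^esub> b)"
      by (rule lincomb_superset[OF p c' F(1) supp F(2)])
    also have "\<dots> = x"
      unfolding F(4) using Pi_mem[OF F(3)] Pi_mem[OF p] subsetD[OF F(2)]
      by (intro M.finsum_cong' Pi_I smult_closed) (simp_all add: c'_def)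
    finally show ?thesis
      using c' by blast
  qed
  have ker: "c = (\<lambda>b. \<zero>\<^bsub>R\<^esub>)" if c: "c \<in> carrier ?N" and "?L c = \<zero>\<^bsub>M\<^esub>" for c
  proof -
    let ?F = "{b. c b \<noteq> \<zero>\<^bsub>R\<^esub>}"
    have F: "finite ?F" "?F \<subseteq> B" "c \<in> ?F \<rightarrow> carrier R"
      using c by (auto simp: free_module_carrier)
    have "(\<Oplus>\<^bsub>M\<^esub>b\<in>?F. c b \<odot>\<^bsub>M\<^esub> b) = \<zero>\<^bsub>M\<^esub>"
      using that(2) by (simp add: lincomb_def)
    note 0 = basis[unfolded module_basis_def, THEN conjunct2, THEN conjunct2, rule_format, OF F this]
    show ?thesis
    proof (rule ext, rule ccontr)
      fix b assume "c b \<noteq> \<zero>\<^bsub>R\<^esub>"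
      then show False using 0[of b] by simp
    qed
  qed
  have "inj_on ?L (carrier ?N)"
  proof (rule inj_onI)
    fix c c' assume c: "c \<in> carrier ?N" and c': "c' \<in> carrier ?N" and eq: "?L c = ?L c'"
    have m: "(\<lambda>b. \<ominus>\<^bsub>R\<^esub> \<one>\<^bsub>R\<^esub> \<otimes>\<^bsub>R\<^esub> c' b) \<in> carrier ?N"
      using c' by (intro R.free_module_smult_closed) simp_all
    have "?L (\<lambda>b. c b \<oplus>\<^bsub>R\<^esub> \<ominus>\<^bsub>R\<^esub> \<one>\<^bsub>R\<^esub> \<otimes>\<^bsub>R\<^esub> c' b) = \<zero>\<^bsub>M\<^esub>"
      using lincomb_add[OF p c m] lincomb_smult[OF p _ c', of "\<ominus>\<^bsub>R\<^esub> \<one>\<^bsub>R\<^esub>"] eq L.hom_closed[OF c']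
      by (simp add: smult_l_minus M.r_neg)
    then have "(\<lambda>b. c b \<oplus>\<^bsub>R\<^esub> \<ominus>\<^bsub>R\<^esub> \<one>\<^bsub>R\<^esub> \<otimes>\<^bsub>R\<^esub> c' b) = (\<lambda>b. \<zero>\<^bsub>R\<^esub>)"
      using R.free_module_add_closed[OF c m] by (intro ker)
    then have *: "c b \<oplus>\<^bsub>R\<^esub> \<ominus>\<^bsub>R\<^esub> \<one>\<^bsub>R\<^esub> \<otimes>\<^bsub>R\<^esub> c' b = \<zero>\<^bsub>R\<^esub>" for b
      by (rule fun_cong)
    show "c = c'"
    proof (rule ext)
      fix b
      have "c b \<in> carrier R" "c' b \<in> carrier R"
        using c c' by (auto simp: free_module_carrier)
      then show "c b = c' b"
        using *[of b] R.minus_equality[of "c b" "\<ominus>\<^bsub>R\<^esub> c' b"] by (simp add: R.l_minus)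
    qed
  qed
  define coord where "coord = inv_into (carrier ?N) ?L"
  have coord: "coord x \<in> carrier ?N" "?L (coord x) = x" if "x \<in> carrier M" for x
  proof -
    have "x \<in> ?L ` carrier ?N"
      using surj[OF that] by blast
    then show "coord x \<in> carrier ?N" "?L (coord x) = x"
      unfolding coord_def by (rule inv_into_into, rule f_inv_into_f)
  qed
  have coord_L: "coord (?L c) = c" if "c \<in> carrier ?N" for c
    unfolding coord_def using \<open>inj_on ?L (carrier ?N)\<close> that by (rule inv_into_f_f)
  show ?thesis
  proof (rule free_of_coordinates[OF principal, of B "\<lambda>b x. coord x b"])
    show "functional R M (\<lambda>x. coord x b)" for b
      unfolding functional_def
    proof (intro conjI ballI abelian_group_homI M.abelian_group_axioms R.abelian_group_axioms)
      show "(\<lambda>x. coord x b) \<in> carrier M \<rightarrow> carrier R"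
        using functional_closed[OF R.free_module_eval coord(1)] by (rule Pi_I)
      show "coord (x \<oplus>\<^bsub>M\<^esub> y) b = coord x b \<oplus>\<^bsub>R\<^esub> coord y b"
        if "x \<in> carrier M" "y \<in> carrier M" for x y
        using coord_L[OF R.free_module_add_closed[OF coord(1) coord(1)], OF that]
          lincomb_add[OF p coord(1) coord(1), OF that] coord(2) that by simp
      show "coord (a \<odot>\<^bsub>M\<^esub> x) b = a \<otimes>\<^bsub>R\<^esub> coord x b"
        if "a \<in> carrier R" "x \<in> carrier M" for a x
        using coord_L[OF R.free_module_smult_closed[OF _ coord(1)], OF that]
          lincomb_smult[OF p _ coord(1), OF that] coord(2) that by simp
    qed
    show "finite {b \<in> B. coord x b \<noteq> \<zero>\<^bsub>R\<^esub>}" if "x \<in> carrier M" for x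
      using coord(1)[OF that] by (simp add: free_module_carrier)
    show "x = \<zero>\<^bsub>M\<^esub>" if x: "x \<in> carrier M" and z: "\<And>b. b \<in> B \<Longrightarrow> coord x b = \<zero>\<^bsub>R\<^esub>" for x
    proof -
      have "coord x = \<zero>\<^bsub>?N\<^esub>"
        by (rule free_module_zeroI[OF coord(1)[OF x] z])
      then show ?thesis
        using coord(2)[OF x] L.hom_zero by simp
    qed
  qed
qed

lemma homogeneous_coarsening:
  assumes "\<psi> \<in> carrier G \<rightarrow> carrier H"
  shows "homogeneous G \<M> \<subseteq> homogeneous H (coarsening G \<psi> M \<M>)"
proof (rule subsetI)
  fix x assume "x \<in> homogeneous G \<M>"
  then obtain g where g: "g \<in> carrier G" "x \<in> \<M> g"
    by (auto simp: homogeneous_def)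
  have "x = (\<Oplus>\<^bsub>M\<^esub>i\<in>{g}. x)"
    using MD.summand_closed[OF g] by simp
  then have "x \<in> coarsening G \<psi> M \<M> (\<psi> g)"
    unfolding coarsening_def family_sum_def mem_Collect_eq using g
    by (intro exI[of _ "{g}"] exI[of _ "\<lambda>_. x"]) auto
  then show "x \<in> homogeneous H (coarsening G \<psi> M \<M>)"
    using assms g(1) by (auto simp: homogeneous_def)
qed

end

theorem mainTheorem8:
  fixes G :: "'g monoid" and H :: "'h monoid" and \<psi> :: "'g \<Rightarrow> 'h"
    and R :: "'r ring" and \<R> :: "'g \<Rightarrow> 'r set"
    and M :: "('r, 'm) module" and \<M> :: "'g \<Rightarrow> 'm set"
  assumes "comm_group G" and "comm_group H" and "\<psi> \<in> epi G H"
    and "graded_principal G R \<R>"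
    and "graded_module G R \<R> M \<M>"
  shows "(graded_projective TYPE('g \<times> 'm \<Rightarrow> 'r) G R \<R> M \<M> \<longrightarrow> graded_free G R M \<M>) \<and>
         (graded_free G R M \<M> \<longleftrightarrow> graded_free H R M (coarsening G \<psi> M \<M>))"
proof -
  interpret graded_mod G R \<R> M \<M>
    using assms(5) by (rule graded_mod.intro)
  have "\<psi> \<in> carrier G \<rightarrow> carrier H"
    using assms(3) by (auto simp: epi_def hom_def)
  then have "graded_free H R M (coarsening G \<psi> M \<M>)" if "graded_free G R M \<M>"
    using that homogeneous_coarsening unfolding graded_free_def by blast
  moreover have "graded_free G R M \<M>" if "graded_free H R M (coarsening G \<psi> M \<M>)"
    using that basis_imp_free[OF assms(4)] unfolding graded_free_def by blast
  ultimately show ?thesis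
    using projective_imp_free[OF assms(4)] by blast
qed

end
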